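(* Let $f\in F_r$, $\beta>0$ and $\varphi\in(0,1)$. There exists $m_0$ such that for all $m\ge m_0$, for any mesh $\{x_i\}_{i=0}^m$ satisfying $\max_{0\le i\le m-1}(x_{i+1}-x_i)\le K\ell(m)$, and any points $\bar x_{i+1}$ with $x_i<\bar x_{i+1}\le b$ and $\bar x_{i+1}-x_i\le\gamma(x_{i+1}-x_i)$, it holds $$\sup_{t\in[x_i,x_{i+1}]}\|z_i(t)-l_{i,r+1}(t)\|\le G_i\,h_i^{r+1},\qquad i=0,1,\dots,m-1,$$ where $h_i=x_{i+1}-x_i$ and $$G_i=G_i(f)=\frac83\Bigl(\bigl\|\tilde H_i[\bar t_0,\bar t_1,\dots,\bar t_r]\bigr\|+\beta\Bigr)(1+\varphi).$$
   Context: **Problem.** Let $a<b$, $d,r\ge1$ integers, $\eta\in\mathbb R^d$, $\|\cdot\|$ the maximum norm in $\mathbb R^d$. Consider $z'(t)=f(t,z(t))$, $t\in[a,b]$, $z(a)=\eta$. $F_r$ is the class of continuous $f:[a,b]\times\mathbb R^d\to\mathbb R^d$ such that for some $L\ge0$, $\|f(t,y)-f(t,\bar y)\|\le L\|y-\bar y\|$ for all $t\in[a,b]$, $y,\bar y\in\mathbb R^d$, and $f\in C^r([a,b]\times D)$, where $D=\{y\in\mathbb R^d:\|y\|\le\sup_{t\in[a,b]}\|z(t)\|+1\}$ and $z$ is the unique solution. **Meshes.** Meshes are $a=x_0<x_1<\dots<x_m=b$. A nonincreasing sequence $\ell(m)\to0$ and constants $K$ (possibly depending on $f,a,b,\eta$)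 and $\gamma\ge1$ (possibly depending on $f$, but independent of $i$ and $m$) are fixed. **Method $\phi^*$.** Put $y_0=\eta$. Given $y_i$, let $t_0,\dots,t_{r-1}$ be equidistant nodes in $[x_i,x_{i+1}]$ with $t_0=x_i$ if $r=1$, and $t_0=x_i$, $t_{r-1}=x_{i+1}$ if $r\ge2$. Put $l_{i,0}\equiv y_i$; given $l_{i,j}$, let $q_{i,j}$ be the Lagrange interpolation polynomial of degree at most $r-1$ of $t\mapsto f(t,l_{i,j}(t))$ at $t_0,\dots,t_{r-1}$, and $l_{i,j+1}(t)=y_i+\int_{x_i}^tq_{i,j}(\xi)\,d\xi$. The final approximation on $[x_i,x_{i+1}]$ is $l_{i,r+1}$, and $y_{i+1}=l_{i,r+1}(x_{i+1})$. The local solution $z_i$ satisfies $z_i'(t)=f(t,z_i(t))$, $z_i(x_i)=y_i$. **Auxiliary approximation.** $\bar t_0=x_i,\bar t_1,\dots,\bar t_r=\bar x_{i+1}$ are equidistant points of $[x_i,\bar x_{i+1}]$ (dependence on $i$ suppressed). $\bar l_{i,r+1}$ is obtained on $[x_i,\bar x_{i+1}]$ by the same iteration as $l_{i,r+1}$ (started from the constant $y_i$), with interpolation nodes $\bar t_0,\dots,\bar t_{r-1}$. $\tilde H_i(t)=f(t,\bar l_{i,r+1}(t))$, and $\tilde H_i[\bar t_0,\dots,\bar t_r]$ is its componentwise divided difference. *)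

theory Defs
  imports "HOL-Analysis.Analysis"
begin

text \<open>The maximum norm on \<open>real ^ 'd\<close> is \<^const>\<open>infnorm\<close>.\<close>

definition ivp_solution ::
  "(real \<Rightarrow> real ^ 'd \<Rightarrow> real ^ 'd) \<Rightarrow> real \<Rightarrow> real \<Rightarrow> real ^ 'd \<Rightarrow> (real \<Rightarrow> real ^ 'd) \<Rightarrow> bool"
where
  "ivp_solution f s T y z \<longleftrightarrow>
     z s = y \<and> (\<forall>t\<in>{s..T}. (z has_vector_derivative f t (z t)) (at t within {s..T}))"

text \<open>
  Class C^k on a set S, with derivatives taken within S. It is used below for compact convex sets
  with nonempty interior, where derivatives within S are unique and where the notion is the usual
  one: all partial derivatives up to order k exist in the interior and extend continuously to S.
  In finite dimension, continuity of the derivative as a linear map is continuity of all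
  directional derivatives.
\<close>

primrec C_on :: "nat \<Rightarrow> 'a::euclidean_space set \<Rightarrow> ('a \<Rightarrow> 'b::euclidean_space) \<Rightarrow> bool" where
  "C_on 0 S g \<longleftrightarrow> continuous_on S g"
| "C_on (Suc k) S g \<longleftrightarrow>
     (\<exists>g'. (\<forall>x\<in>S. (g has_derivative g' x) (at x within S)) \<and> (\<forall>v. C_on k S (\<lambda>x. g' x v)))"

definition solution_tube :: "real \<Rightarrow> real \<Rightarrow> (real \<Rightarrow> real ^ 'd) \<Rightarrow> (real ^ 'd) set" where
  "solution_tube a b z = {y. infnorm y \<le> (SUP t\<in>{a..b}. infnorm (z t)) + 1}"

text \<open>
  By the Lipschitz condition the solution \<open>z\<close> exists and is unique on \<open>{a..b}\<close>, and only its
  values there enter the last clause.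
\<close>

definition F_class ::
  "real \<Rightarrow> real \<Rightarrow> real ^ 'd \<Rightarrow> nat \<Rightarrow> (real \<Rightarrow> real ^ 'd \<Rightarrow> real ^ 'd) set"
where
  "F_class a b \<eta> r = {f.
     continuous_on ({a..b} \<times> UNIV) (\<lambda>(t, y). f t y) \<and>
     (\<exists>L\<ge>0. \<forall>t\<in>{a..b}. \<forall>y y'. infnorm (f t y - f t y') \<le> L * infnorm (y - y')) \<and>
     (\<exists>z. ivp_solution f a b \<eta> z \<and>
          C_on r ({a..b} \<times> solution_tube a b z) (\<lambda>(t, y). f t y))}"

definition mesh :: "real \<Rightarrow> real \<Rightarrow> nat \<Rightarrow> (nat \<Rightarrow> real) \<Rightarrow> bool" where
  "mesh a b m x \<longleftrightarrow> x 0 = a \<and> x m = b \<and> (\<forall>i<m. x i < x (Suc i))"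

definition mesh_size :: "nat \<Rightarrow> (nat \<Rightarrow> real) \<Rightarrow> real" where
  "mesh_size m x = Max ((\<lambda>i. x (Suc i) - x i) ` {..<m})"

text \<open>Value at \<open>t\<close> of the interpolation polynomial of \<open>g\<close> at the nodes
  \<open>\<tau> 0, \<dots>, \<tau> (n - 1)\<close>, in Lagrange form.\<close>

definition lagrange_interp ::
  "nat \<Rightarrow> (nat \<Rightarrow> real) \<Rightarrow> (real \<Rightarrow> 'b::real_vector) \<Rightarrow> real \<Rightarrow> 'b"
where
  "lagrange_interp n \<tau> g t =
     (\<Sum>p<n. (\<Prod>q\<in>{..<n} - {p}. (t - \<tau> q) / (\<tau> p - \<tau> q)) *\<^sub>R g (\<tau> p))"

text \<open>\<open>divided_diff g \<tau> p k\<close> is the divided difference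
  \<open>g[\<tau> p, \<dots>, \<tau> (p + k)]\<close>; for vector-valued \<open>g\<close> it acts componentwise.\<close>

primrec divided_diff ::
  "(real \<Rightarrow> 'b::real_vector) \<Rightarrow> (nat \<Rightarrow> real) \<Rightarrow> nat \<Rightarrow> nat \<Rightarrow> 'b"
where
  "divided_diff g \<tau> p 0 = g (\<tau> p)"
| "divided_diff g \<tau> p (Suc k) =
     (1 / (\<tau> (p + Suc k) - \<tau> p)) *\<^sub>R (divided_diff g \<tau> (Suc p) k - divided_diff g \<tau> p k)"

text \<open>The iterates \<open>l\<^sub>0, l\<^sub>1, \<dots>\<close> started from the constant \<open>y\<close> at the
  left end point \<open>s\<close>, with interpolation nodes \<open>\<tau> 0, \<dots>, \<tau> (r - 1)\<close>; they
  are meaningful for \<open>t \<ge> s\<close>.\<close>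

primrec interp_iter ::
  "(real \<Rightarrow> real ^ 'd \<Rightarrow> real ^ 'd) \<Rightarrow> nat \<Rightarrow> (nat \<Rightarrow> real) \<Rightarrow> real \<Rightarrow> real ^ 'd \<Rightarrow>
   nat \<Rightarrow> real \<Rightarrow> real ^ 'd"
where
  "interp_iter f r \<tau> s y 0 = (\<lambda>t. y)"
| "interp_iter f r \<tau> s y (Suc j) =
     (\<lambda>t. y + integral {s..t} (lagrange_interp r \<tau> (\<lambda>u. f u (interp_iter f r \<tau> s y j u))))"

definition method_nodes :: "nat \<Rightarrow> real \<Rightarrow> real \<Rightarrow> nat \<Rightarrow> real" where
  "method_nodes r s e p = (if r = 1 then s else s + real p * (e - s) / (real r - 1))"

definition local_approx ::
  "(real \<Rightarrow> real ^ 'd \<Rightarrow> real ^ 'd) \<Rightarrow> nat \<Rightarrow> real \<Rightarrow> real \<Rightarrow> real ^ 'd \<Rightarrow> real \<Rightarrow> real ^ 'd"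
where
  "local_approx f r s e y = interp_iter f r (method_nodes r s e) s y (r + 1)"

primrec method_values ::
  "(real \<Rightarrow> real ^ 'd \<Rightarrow> real ^ 'd) \<Rightarrow> nat \<Rightarrow> real ^ 'd \<Rightarrow> (nat \<Rightarrow> real) \<Rightarrow> nat \<Rightarrow> real ^ 'd"
where
  "method_values f r \<eta> x 0 = \<eta>"
| "method_values f r \<eta> x (Suc i) =
     local_approx f r (x i) (x (Suc i)) (method_values f r \<eta> x i) (x (Suc i))"

text \<open>The auxiliary approximation on \<open>{s..e}\<close> uses the \<open>r + 1\<close> equidistant points of
  \<open>{s..e}\<close> for the divided difference, but only the first \<open>r\<close> of them for the
  interpolation.\<close>

definition aux_nodes :: "nat \<Rightarrow> real \<Rightarrow> real \<Rightarrow> nat \<Rightarrow> real" where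
  "aux_nodes r s e p = s + real p * (e - s) / real r"

definition aux_approx ::
  "(real \<Rightarrow> real ^ 'd \<Rightarrow> real ^ 'd) \<Rightarrow> nat \<Rightarrow> real \<Rightarrow> real \<Rightarrow> real ^ 'd \<Rightarrow> real \<Rightarrow> real ^ 'd"
where
  "aux_approx f r s e y = interp_iter f r (aux_nodes r s e) s y (r + 1)"

definition H_tilde ::
  "(real \<Rightarrow> real ^ 'd \<Rightarrow> real ^ 'd) \<Rightarrow> nat \<Rightarrow> real \<Rightarrow> real \<Rightarrow> real ^ 'd \<Rightarrow> real \<Rightarrow> real ^ 'd"
where
  "H_tilde f r s e y t = f t (aux_approx f r s e y t)"

definition G_coeff ::
  "(real \<Rightarrow> real ^ 'd \<Rightarrow> real ^ 'd) \<Rightarrow> nat \<Rightarrow> real \<Rightarrow> real \<Rightarrow> real \<Rightarrow> real \<Rightarrow> real ^ 'd \<Rightarrow> real"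
where
  "G_coeff f r \<beta> \<phi> s e y =
     8 / 3 * (infnorm (divided_diff (H_tilde f r s e y) (aux_nodes r s e) 0 r) + \<beta>) * (1 + \<phi>)"

end

theory Submission
  imports Defs "HOL-Computational_Algebra.Polynomial"
begin

text \<open>
  Write \<open>h\<close> for the step and \<open>g(t) = f(t, z\<^sub>i(t))\<close> for the right-hand side along the local
  solution. Every sweep of the iteration contracts the distance to \<open>z\<^sub>i\<close> by a factor \<open>O(h)\<close>, up to
  the interpolation error of \<open>g\<close>, which contributes \<open>O(h\<^bsup>r+1\<^esup>)\<close> after integration. After \<open>r\<close>
  sweeps the distance is therefore \<open>O(h\<^bsup>r+1\<^esup>)\<close>, and the last sweep turns it into a perturbation
  of order \<open>h\<^bsup>r+2\<^esup>\<close>. What remains is the integral of \<open>g\<close> minus its own interpolation polynomial;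
  by the remainder formula each of its components is at most \<open>h\<^bsup>r+1\<^esup> sup |g\<^bsup>(r)\<^esup>| / r!\<close>.

  The divided difference in the bound estimates this supremum. If \<open>w\<close> solves the same local problem
  on the auxiliary interval, of length \<open>h'\<close>, then the divided difference of \<open>f(t, w(t))\<close> is a value
  of its \<open>r\<close>-th derivative over \<open>r!\<close>, at a point that depends on the component; this is why the
  main estimate is made for one component at a time. Replacing \<open>w\<close> by the auxiliary approximation
  changes the function by \<open>O(h'\<^bsup>r+1\<^esup>)\<close>, hence its divided difference by \<open>O(h')\<close>, however small
  \<open>h'\<close> is compared with \<open>h\<close>.

  All constants have to be uniform in the step and in the mesh. The \<open>r\<close>-th derivative along any
  solution is a fixed function \<open>F\<^sub>r\<close> evaluated on the curve, where \<open>F\<^sub>0 = f\<close> and \<open>F\<^bsub>k+1\<^esub>\<close> is the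
  derivative of \<open>F\<^sub>k\<close> in direction \<open>(1, f)\<close>. It is uniformly continuous on the compact tube, and
  the curves involved stay near their common starting point, so any two values of it on them differ by
  less than a fraction of \<open>\<beta>\<close> once the steps are small. That the method does not leave the tube
  follows from its global convergence, which is proved by comparing the iterates directly with the
  exact solution. The lemmas that carry the argument are
  \<open>iterated_directional_derivatives\<close>, \<open>lagrange_interp_remainder\<close>, \<open>divided_diff_mean_value\<close>,
  \<open>iterate_local_error\<close>, \<open>method_values_converge\<close> and \<open>local_error_component_bound\<close>.
\<close>

section \<open>Total derivatives along integral curves\<close>
lemma C_on_cong:
  assumes "C_on k S g" "\<And>x. x \<in> S \<Longrightarrow> g x = h x"
  shows "C_on k S h"
proof (cases k)
  case 0
  then show ?thesis using assms continuous_on_cong[of S S g h] by auto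
next
  case (Suc n)
  then obtain g' where
    g': "\<And>x. x \<in> S \<Longrightarrow> (g has_derivative g' x) (at x within S)" "\<And>v. C_on n S (\<lambda>x. g' x v)"
    using assms(1) by auto
  have "(h has_derivative g' x) (at x within S)" if "x \<in> S" for x
    using has_derivative_transform[OF that _ g'(1)[OF that]] assms(2) by auto
  then show ?thesis using Suc g'(2) by auto
qed

lemma C_on_Suc_imp: "C_on (Suc k) S g \<Longrightarrow> C_on k S g"
proof (induction k arbitrary: g)
  case 0
  then show ?case using has_derivative_continuous_on by auto
next
  case (Suc k)
  then obtain g' where "\<forall>x\<in>S. (g has_derivative g' x) (at x within S)"
    "\<forall>v. C_on (Suc k) S (\<lambda>x. g' x v)" by auto
  with Suc.IH show ?case by (auto intro!: exI[of _ g'] simp del: C_on.simps(2) simp: C_on.simps(2)[of k])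
qed

lemma C_on_imp_continuous_on: "C_on k S g \<Longrightarrow> continuous_on S g"
proof (induction k)
  case (Suc k)
  then show ?case using C_on_Suc_imp by blast
qed simp

lemma C_on_const: "C_on k S (\<lambda>x. c)"
proof (induction k arbitrary: c)
  case (Suc k)
  have "\<forall>x\<in>S. ((\<lambda>x. c) has_derivative (\<lambda>v. 0)) (at x within S)" by simp
  then show ?case using Suc[of 0] unfolding C_on.simps(2) by (intro exI[of _ "\<lambda>x v. 0"]) simp
qed simp

lemma C_on_add: "C_on k S g \<Longrightarrow> C_on k S h \<Longrightarrow> C_on k S (\<lambda>x. g x + h x)"
proof (induction k arbitrary: g h)
  case 0
  then show ?case by (auto intro: continuous_on_add)
next
  case (Suc k)
  obtain g' h' where
    "\<forall>x\<in>S. (g has_derivative g' x) (at x within S)" "\<forall>v. C_on k S (\<lambda>x. g' x v)"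
    "\<forall>x\<in>S. (h has_derivative h' x) (at x within S)" "\<forall>v. C_on k S (\<lambda>x. h' x v)"
    using Suc.prems by auto
  then show ?case using Suc.IH unfolding C_on.simps(2)
    by (intro exI[of _ "\<lambda>x v. g' x v + h' x v"]) (auto intro: has_derivative_add)
qed

lemma C_on_sum:
  "finite A \<Longrightarrow> (\<And>i. i \<in> A \<Longrightarrow> C_on k S (g i)) \<Longrightarrow> C_on k S (\<lambda>x. \<Sum>i\<in>A. g i x)"
  by (induction A rule: finite_induct) (auto intro: C_on_const C_on_add)

lemma C_on_bounded_linear:
  assumes "bounded_linear A"
  shows "C_on k S g \<Longrightarrow> C_on k S (\<lambda>x. A (g x))"
proof (induction k arbitrary: g)
  case 0
  then show ?case using bounded_linear.continuous_on[OF assms] by simp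
next
  case (Suc k)
  obtain g' where "\<forall>x\<in>S. (g has_derivative g' x) (at x within S)" "\<forall>v. C_on k S (\<lambda>x. g' x v)"
    using Suc.prems by auto
  then show ?case using Suc.IH unfolding C_on.simps(2)
    by (intro exI[of _ "\<lambda>x v. A (g' x v)"]) (auto intro: bounded_linear.has_derivative[OF assms])
qed

lemma C_on_scaleR:
  fixes u :: "'a::euclidean_space \<Rightarrow> real"
  shows "C_on k S u \<Longrightarrow> C_on k S g \<Longrightarrow> C_on k S (\<lambda>x. u x *\<^sub>R g x)"
proof (induction k arbitrary: u g)
  case 0
  then show ?case by (auto intro: continuous_on_scaleR)
next
  case (Suc k)
  obtain u' g' where *:
    "\<forall>x\<in>S. (u has_derivative u' x) (at x within S)" "\<forall>v. C_on k S (\<lambda>x. u' x v)"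
    "\<forall>x\<in>S. (g has_derivative g' x) (at x within S)" "\<forall>v. C_on k S (\<lambda>x. g' x v)"
    using Suc.prems by auto
  have "C_on k S u" "C_on k S g" using Suc.prems C_on_Suc_imp by blast+
  with * show ?case using Suc.IH unfolding C_on.simps(2)
    by (intro exI[of _ "\<lambda>x v. u x *\<^sub>R g' x v + u' x v *\<^sub>R g x"])
       (auto intro!: has_derivative_scaleR C_on_add)
qed

text \<open>The definition of \<^const>\<open>C_on\<close> controls derivatives in fixed directions only. A variable
  direction is reduced to these by expanding it in the standard basis, which costs products but no
  order of differentiability.\<close>
lemma C_on_directional_derivative:
  fixes g :: "'a::euclidean_space \<Rightarrow> 'b::euclidean_space" and h :: "'a \<Rightarrow> 'a"
  assumes "C_on (Suc k) S g" "C_on k S h"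
  shows "\<exists>g'. (\<forall>x\<in>S. (g has_derivative g' x) (at x within S)) \<and> C_on k S (\<lambda>x. g' x (h x))"
proof -
  obtain g' where g': "\<forall>x\<in>S. (g has_derivative g' x) (at x within S)" "\<forall>v. C_on k S (\<lambda>x. g' x v)"
    using assms(1) by auto
  have "C_on k S (\<lambda>x. \<Sum>b\<in>Basis. (h x \<bullet> b) *\<^sub>R g' x b)"
    using g'(2) assms(2) C_on_bounded_linear[OF bounded_linear_inner_left]
    by (intro C_on_sum C_on_scaleR) auto
  moreover have "(\<Sum>b\<in>Basis. (h x \<bullet> b) *\<^sub>R g' x b) = g' x (h x)" if "x \<in> S" for x
  proof -
    have "linear (g' x)" using g'(1) that has_derivative_linear by blast
    then have "g' x (\<Sum>b\<in>Basis. (h x \<bullet> b) *\<^sub>R b) = (\<Sum>b\<in>Basis. (h x \<bullet> b) *\<^sub>R g' x b)"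
      by (simp add: linear_sum linear_cmul)
    then show ?thesis by (simp add: euclidean_representation)
  qed
  ultimately have "C_on k S (\<lambda>x. g' x (h x))" by (rule C_on_cong)
  with g'(1) show ?thesis by blast
qed

text \<open>With \<open>h\<close> the extended vector field \<open>(1, f)\<close>, the functions \<open>F k\<close> are the \<open>k\<close>-th total
  derivatives of \<open>g\<close> along all solutions simultaneously. Having them as functions on \<open>S\<close>, and not one
  family for each solution, is what makes later bounds and moduli of continuity uniform.\<close>
lemma iterated_directional_derivatives:
  fixes g :: "'a::euclidean_space \<Rightarrow> 'b::euclidean_space" and h :: "'a \<Rightarrow> 'a"
  assumes "C_on n S g" "C_on n S h"
  shows "\<exists>F. F 0 = g \<and> (\<forall>k\<le>n. continuous_on S (F k)) \<and>
    (\<forall>k<n. \<forall>x\<in>S. \<exists>A. (F k has_derivative A) (at x within S) \<and> F (Suc k) x = A (h x))"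
  using assms
proof (induction n arbitrary: g)
  case 0
  then show ?case by (intro exI[of _ "\<lambda>k. g"]) simp
next
  case (Suc n)
  have h: "C_on n S h" using Suc.prems(2) by (rule C_on_Suc_imp)
  obtain g' where g': "\<And>x. x \<in> S \<Longrightarrow> (g has_derivative g' x) (at x within S)"
      "C_on n S (\<lambda>x. g' x (h x))"
    using C_on_directional_derivative[OF Suc.prems(1) h] by blast
  obtain F where F: "F 0 = (\<lambda>x. g' x (h x))" "\<And>k. k \<le> n \<Longrightarrow> continuous_on S (F k)"
    "\<And>k x. k < n \<Longrightarrow> x \<in> S \<Longrightarrow>
       \<exists>A. (F k has_derivative A) (at x within S) \<and> F (Suc k) x = A (h x)"
    using Suc.IH[OF g'(2) h] by blast
  show ?case
  proof (intro exI[of _ "case_nat g F"] conjI allI impI ballI)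
    show "continuous_on S (case_nat g F k)" if "k \<le> Suc n" for k
      using that F(2) C_on_imp_continuous_on[OF Suc.prems(1)] by (cases k) auto
    show "\<exists>A. (case_nat g F k has_derivative A) (at x within S) \<and> case_nat g F (Suc k) x = A (h x)"
      if "k < Suc n" "x \<in> S" for k x
      using that F(1,3) g'(1) by (cases k) auto
  qed simp
qed

lemma derivative_along_integral_curve:
  fixes f :: "real \<Rightarrow> real ^ 'd \<Rightarrow> real ^ 'd" and G :: "real \<times> (real ^ 'd) \<Rightarrow> real ^ 'd"
  assumes "(w has_vector_derivative f t (w t)) (at t within T)" "t \<in> T"
    and "(\<lambda>t. (t, w t)) ` T \<subseteq> S"
    and "(G has_derivative A) (at (t, w t) within S)" "G' = A (1, f t (w t))"
  shows "((\<lambda>t. G (t, w t)) has_vector_derivative G') (at t within T)"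
proof -
  have "((\<lambda>t. (t, w t)) has_derivative (\<lambda>x. (x, x *\<^sub>R f t (w t)))) (at t within T)"
    using assms(1) unfolding has_vector_derivative_def
    by (auto intro: has_derivative_Pair has_derivative_ident)
  from has_derivative_in_compose[OF this has_derivative_subset[OF assms(4,3)]]
  have *: "((\<lambda>t. G (t, w t)) has_derivative (\<lambda>x. A (x, x *\<^sub>R f t (w t)))) (at t within T)" .
  have "A (x, x *\<^sub>R f t (w t)) = x *\<^sub>R G'" for x
    using linear_cmul[OF has_derivative_linear[OF assms(4)], of x "(1, f t (w t))"] assms(5) by simp
  with * show ?thesis unfolding has_vector_derivative_def by simp
qed

section \<open>Interpolation remainder and divided differences\<close>

text \<open>The zeros come from Rolle's theorem between consecutive points of \<open>X\<close>. Keeping them strictly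
  below \<open>Max X\<close> is the invariant that guarantees that the next zero, found beyond the previous maximum,
  is a new one.\<close>
lemma zeros_of_derivative:
  fixes g g' :: "real \<Rightarrow> real"
  assumes der: "\<And>t. t \<in> {s..e} \<Longrightarrow> (g has_real_derivative g' t) (at t within {s..e})"
    and "card X = Suc n" "X \<subseteq> {s..e}" "\<And>x. x \<in> X \<Longrightarrow> g x = 0"
  shows "\<exists>Y. finite Y \<and> card Y = n \<and> Y \<subseteq> {s..<Max X} \<and> (\<forall>y\<in>Y. g' y = 0)"
  using assms(2-)
proof (induction n arbitrary: X)
  case 0
  then show ?case by (intro exI[of _ "{}"]) auto
next
  case (Suc n)
  have fin: "finite X" using Suc.prems(1) card.infinite by fastforce
  define m where "m = Max X"
  define m' where "m' = Max (X - {m})"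
  have m: "m \<in> X" unfolding m_def using fin Suc.prems(1) by (intro Max_in) auto
  have card: "card (X - {m}) = Suc n" using m fin Suc.prems(1) by simp
  have ne: "X - {m} \<noteq> {}" using card by (metis card.empty nat.simps(3))
  have m': "m' \<in> X" "m' \<noteq> m" using Max_in[of "X - {m}"] fin ne unfolding m'_def by auto
  have lt: "m' < m" using m' fin unfolding m_def by (metis Max_ge order_le_neq_trans)
  obtain Y where Y: "finite Y" "card Y = n" "Y \<subseteq> {s..<m'}" "\<forall>y\<in>Y. g' y = 0"
    using Suc.IH[OF card] Suc.prems unfolding m'_def by blast
  have sub: "{m'..m} \<subseteq> {s..e}" using m m' Suc.prems(2) by auto
  have "\<exists>z. m' < z \<and> z < m \<and> (\<lambda>v. g' z * v) = (\<lambda>v. 0)"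
  proof (rule Rolle_deriv[OF lt, of g])
    show "g m' = g m" using m m' Suc.prems(3) by simp
    show "continuous_on {m'..m} g"
      using der sub by (meson DERIV_continuous_on continuous_on_subset)
    show "(g has_derivative (*) (g' x)) (at x)" if "m' < x" "x < m" for x
    proof -
      have "x \<in> interior {s..e}" using that sub lt by (auto simp: interior_atLeastAtMost_real)
      then have "(g has_real_derivative g' x) (at x)"
        using der[of x] by (metis at_within_interior interior_subset subsetD)
      then show ?thesis by (simp add: has_field_derivative_def)
    qed
  qed
  then obtain z where z: "m' < z" "z < m" "g' z = 0" by (metis mult_1_right)
  have "z \<notin> Y" using Y(3) z by auto
  then show ?case
    using Y z m' Suc.prems(2) unfolding m_def[symmetric] by (intro exI[of _ "insert z Y"]) auto
qed

lemma generalized_Rolle: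
  fixes g :: "nat \<Rightarrow> real \<Rightarrow> real"
  assumes "\<And>k t. k < n \<Longrightarrow> t \<in> {s..e} \<Longrightarrow> (g k has_real_derivative g (Suc k) t) (at t within {s..e})"
    and "card X = Suc n" "X \<subseteq> {s..e}" "\<And>x. x \<in> X \<Longrightarrow> g 0 x = 0"
  shows "\<exists>\<zeta>\<in>{s..e}. g n \<zeta> = 0"
  using assms
proof (induction n arbitrary: g X)
  case 0
  then show ?case by (metis One_nat_def card_1_singletonE insert_subset insert_iff)
next
  case (Suc n)
  have fin: "finite X" "X \<noteq> {}" using Suc.prems(2) card.infinite by fastforce+
  obtain Y where Y: "card Y = Suc n" "Y \<subseteq> {s..<Max X}" "\<forall>y\<in>Y. g 1 y = 0"
    using zeros_of_derivative[of s e "g 0" "g 1" X "Suc n"] Suc.prems by force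
  have "Max X \<le> e" using fin Suc.prems(3) by (metis Max_in atLeastAtMost_iff subsetD)
  then have "Y \<subseteq> {s..e}" using Y(2) by (auto dest!: subsetD)
  then show ?case using Suc.IH[of "\<lambda>k. g (Suc k)" Y] Suc.prems(1) Y by auto
qed

lemma higher_pderiv_degree_le:
  fixes p :: "real poly"
  assumes "degree p \<le> n"
  shows "poly ((pderiv ^^ n) p) x = fact n * coeff p n"
proof -
  have "degree ((pderiv ^^ n) p) = 0" using assms by (simp add: degree_higher_pderiv)
  then obtain c where c: "(pderiv ^^ n) p = [:c:]" by (rule degree_eq_zeroE)
  have "coeff ((pderiv ^^ n) p) 0 = fact n * coeff p n"
    by (simp add: coeff_higher_pderiv pochhammer_fact)
  with c show ?thesis by simp
qed

text \<open>The common source of the interpolation remainder and of the mean value property of divided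
  differences: both read off the leading coefficient of a suitable interpolating polynomial.\<close>
lemma derivative_eq_interpolant_coeff:
  fixes g :: "nat \<Rightarrow> real \<Rightarrow> real"
  assumes der: "\<And>k t. k < n \<Longrightarrow> t \<in> {s..e} \<Longrightarrow>
      (g k has_real_derivative g (Suc k) t) (at t within {s..e})"
    and "card X = Suc n" "X \<subseteq> {s..e}" "degree p \<le> n" "\<And>x. x \<in> X \<Longrightarrow> g 0 x = poly p x"
  shows "\<exists>\<zeta>\<in>{s..e}. g n \<zeta> = fact n * coeff p n"
proof -
  define G where "G k t = g k t - poly ((pderiv ^^ k) p) t" for k t
  have "(G k has_real_derivative G (Suc k) t) (at t within {s..e})" if "k < n" "t \<in> {s..e}" for k t
    unfolding G_def using der[OF that] by (auto intro!: derivative_eq_intros DERIV_subset[OF poly_DERIV])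
  then have "\<exists>\<zeta>\<in>{s..e}. G n \<zeta> = 0"
    by (rule generalized_Rolle[OF _ assms(2,3)]) (auto simp: G_def assms(5))
  then show ?thesis using higher_pderiv_degree_le[OF assms(4)] by (simp add: G_def)
qed

lemma lagrange_interp_at_node:
  assumes "inj_on \<tau> {..<n}" "j < n"
  shows "lagrange_interp n \<tau> g (\<tau> j) = g (\<tau> j)"
proof -
  have "(\<Prod>q\<in>{..<n} - {p}. (\<tau> j - \<tau> q) / (\<tau> p - \<tau> q)) = (if p = j then 1 else 0)"
    if "p < n" for p
  proof (cases "p = j")
    case True
    have "(\<Prod>q\<in>{..<n} - {p}. (\<tau> j - \<tau> q) / (\<tau> p - \<tau> q)) = (\<Prod>q\<in>{..<n} - {p}. 1)"
      using True assms by (intro prod.cong refl) (auto simp: inj_on_def)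
    with True show ?thesis by simp
  next
    case False
    then show ?thesis using assms(2) by (auto intro!: prod_zero bexI[of _ j])
  qed
  then have "lagrange_interp n \<tau> g (\<tau> j) = (\<Sum>p<n. (if p = j then 1 else 0) *\<^sub>R g (\<tau> p))"
    unfolding lagrange_interp_def by (intro sum.cong refl) simp
  also have "\<dots> = (\<Sum>p<n. if p = j then g (\<tau> p) else 0)"
    by (intro sum.cong refl) simp
  also have "\<dots> = g (\<tau> j)" using assms(2) by (simp add: sum.delta)
  finally show ?thesis .
qed

lemma lagrange_interp_is_poly:
  fixes g :: "real \<Rightarrow> real"
  assumes "n \<ge> 1"
  shows "\<exists>P. degree P < n \<and> (\<forall>t. poly P t = lagrange_interp n \<tau> g t)"
proof -
  define B where "B p = (\<Prod>q\<in>{..<n} - {p}. smult (1 / (\<tau> p - \<tau> q)) [:- \<tau> q, 1:])" for p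
  define P where "P = (\<Sum>p<n. smult (g (\<tau> p)) (B p))"
  have "degree (B p) < n" if "p < n" for p
  proof -
    have "degree (B p) \<le> (\<Sum>q\<in>{..<n} - {p}. degree (smult (1 / (\<tau> p - \<tau> q)) [:- \<tau> q, 1:]))"
      unfolding B_def by (rule order_trans[OF degree_prod_sum_le]) (simp_all only: o_def order_refl finite_Diff finite_lessThan)
    also have "\<dots> \<le> (\<Sum>q\<in>{..<n} - {p}. 1)"
      by (intro sum_mono) auto
    also have "\<dots> = n - 1" using that by simp
    finally show ?thesis using assms by simp
  qed
  then have "degree P < n" unfolding P_def
    using assms by (intro degree_sum_less) (auto intro: le_less_trans[OF degree_smult_le])
  moreover have "poly P t = lagrange_interp n \<tau> g t" for t
    unfolding P_def B_def lagrange_interp_def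
    by (auto simp: poly_sum poly_prod mult.commute[of "g _"] simp flip: diff_divide_distrib
        intro!: sum.cong prod.cong)
  ultimately show ?thesis by blast
qed

text \<open>Adding a multiple of the node polynomial to the interpolant produces a polynomial of degree \<open>n\<close>
  that also agrees with the function at \<open>u\<close>; its leading coefficient is the quotient of the error at
  \<open>u\<close> by the node polynomial.\<close>
lemma lagrange_interp_remainder:
  fixes g :: "nat \<Rightarrow> real \<Rightarrow> real"
  assumes der: "\<And>k t. k < n \<Longrightarrow> t \<in> {s..e} \<Longrightarrow>
      (g k has_real_derivative g (Suc k) t) (at t within {s..e})"
    and "n \<ge> 1" and nodes: "inj_on \<tau> {..<n}" "\<And>p. p < n \<Longrightarrow> \<tau> p \<in> {s..e}"
    and u: "u \<in> {s..e}" and M: "\<And>\<zeta>. \<zeta> \<in> {s..e} \<Longrightarrow> \<bar>g n \<zeta>\<bar> \<le> M"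
  shows "\<bar>g 0 u - lagrange_interp n \<tau> (g 0) u\<bar> \<le> M / fact n * (e - s) ^ n"
proof (cases "u \<in> \<tau> ` {..<n}")
  case True
  then have "lagrange_interp n \<tau> (g 0) u = g 0 u" using lagrange_interp_at_node[OF nodes(1)] by auto
  moreover have "0 \<le> M" "s \<le> e" using M[OF u] u by auto
  ultimately show ?thesis by simp
next
  case False
  obtain P where P: "degree P < n" "\<And>t. poly P t = lagrange_interp n \<tau> (g 0) t"
    using lagrange_interp_is_poly[OF assms(2)] by blast
  define W where "W = (\<Prod>q<n. [:- \<tau> q, 1:])"
  have Wu: "poly W t = (\<Prod>q<n. t - \<tau> q)" for t unfolding W_def by (simp add: poly_prod)
  have Wu0: "poly W u \<noteq> 0" unfolding Wu using False by (auto simp: prod_zero_iff)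
  have degW: "degree W = n" unfolding W_def by (subst degree_prod_eq_sum_degree) auto
  have "lead_coeff W = 1" unfolding W_def by (simp add: lead_coeff_prod)
  then have lcW: "coeff W n = 1" using degW by simp
  define \<kappa> where "\<kappa> = (g 0 u - poly P u) / poly W u"
  define Q where "Q = P + smult \<kappa> W"
  have coeff: "coeff Q n = \<kappa>" unfolding Q_def using P(1) lcW by (simp add: coeff_eq_0)
  have deg: "degree Q \<le> n" unfolding Q_def
    using P(1) degW degree_smult_le[of \<kappa> W] by (intro degree_add_le) auto
  have card: "card (insert u (\<tau> ` {..<n})) = Suc n" using False nodes(1) by (simp add: card_image)
  have "\<exists>\<zeta>\<in>{s..e}. g n \<zeta> = fact n * coeff Q n"
  proof (rule derivative_eq_interpolant_coeff[where X = "insert u (\<tau> ` {..<n})"])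
    show "(g k has_real_derivative g (Suc k) t) (at t within {s..e})" if "k < n" "t \<in> {s..e}" for k t
      using der that by blast
    show "insert u (\<tau> ` {..<n}) \<subseteq> {s..e}" using u nodes(2) by auto
    show "card (insert u (\<tau> ` {..<n})) = Suc n" "degree Q \<le> n" by (fact card deg)+
    show "g 0 x = poly Q x" if "x \<in> insert u (\<tau> ` {..<n})" for x
    proof (cases "x = u")
      case True
      then show ?thesis using Wu0 by (simp add: Q_def \<kappa>_def)
    next
      case F: False
      with that obtain j where j: "j < n" "x = \<tau> j" by auto
      then have "poly W x = 0" unfolding Wu by (auto intro!: prod_zero)
      then show ?thesis using j P(2)[of x] lagrange_interp_at_node[OF nodes(1), of j "g 0"] by (simp add: Q_def)
    qed
  qed
  then obtain \<zeta> where "\<zeta> \<in> {s..e}" "g n \<zeta> = fact n * \<kappa>" using coeff by auto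
  then have k: "\<bar>\<kappa>\<bar> \<le> M / fact n" using M[of \<zeta>] by (simp add: abs_mult field_simps)
  have "\<bar>poly W u\<bar> \<le> (\<Prod>q<n. e - s)" unfolding Wu abs_prod
    using u nodes(2) by (intro prod_mono) (fastforce simp: abs_le_iff)
  then have W: "\<bar>poly W u\<bar> \<le> (e - s) ^ n" by simp
  have "g 0 u - lagrange_interp n \<tau> (g 0) u = \<kappa> * poly W u"
    using Wu0 P(2) by (simp add: \<kappa>_def)
  then show ?thesis using mult_mono[OF k W] order_trans[OF abs_ge_zero k] by (simp add: abs_mult)
qed

text \<open>The recursion for divided differences is the leading coefficient of Neville's recursion for
  interpolating polynomials.\<close>
lemma divided_diff_interpolant:
  fixes g :: "real \<Rightarrow> real"
  assumes "inj_on \<tau> {p..p + k}"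
  shows "\<exists>P. degree P \<le> k \<and> coeff P k = divided_diff g \<tau> p k \<and>
    (\<forall>j\<in>{p..p + k}. poly P (\<tau> j) = g (\<tau> j))"
  using assms
proof (induction k arbitrary: p)
  case 0
  then show ?case by (intro exI[of _ "[:g (\<tau> p):]"]) simp
next
  case (Suc k)
  have "inj_on \<tau> {p..p + k}" "inj_on \<tau> {Suc p..Suc p + k}"
    by (rule inj_on_subset[OF Suc.prems]; auto)+
  then obtain P1 P2 where
    P1: "degree P1 \<le> k" "coeff P1 k = divided_diff g \<tau> p k"
      "\<And>j. j \<in> {p..p + k} \<Longrightarrow> poly P1 (\<tau> j) = g (\<tau> j)" and
    P2: "degree P2 \<le> k" "coeff P2 k = divided_diff g \<tau> (Suc p) k"
      "\<And>j. j \<in> {Suc p..Suc p + k} \<Longrightarrow> poly P2 (\<tau> j) = g (\<tau> j)"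
    using Suc.IH[of p] Suc.IH[of "Suc p"] by metis
  define d where "d = \<tau> (p + Suc k) - \<tau> p"
  have d: "d \<noteq> 0" using inj_onD[OF Suc.prems, of "p + Suc k" p] unfolding d_def by auto
  define P where "P = smult (1 / d) ([:- \<tau> p, 1:] * P2 - [:- \<tau> (p + Suc k), 1:] * P1)"
  have "degree P \<le> Suc k"
  proof -
    have "degree ([:c, 1:] * R) \<le> Suc k" if "degree R \<le> k" for c :: real and R
      using order_trans[OF degree_mult_le[of "[:c, 1:]" R], of "Suc k"] that by (simp del: mult_pCons_left)
    then have "degree ([:- \<tau> p, 1:] * P2 - [:- \<tau> (p + Suc k), 1:] * P1) \<le> Suc k"
      using P1(1) P2(1) by (intro degree_diff_le)
    then show ?thesis unfolding P_def using degree_smult_le le_trans by blast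
  qed
  moreover have "coeff P (Suc k) = divided_diff g \<tau> p (Suc k)"
    using P1(1,2) P2(1,2) by (simp add: P_def d_def coeff_eq_0)
  moreover have "poly P (\<tau> j) = g (\<tau> j)" if j: "j \<in> {p..p + Suc k}" for j
  proof -
    have P: "poly P (\<tau> j) = ((\<tau> j - \<tau> p) * poly P2 (\<tau> j) - (\<tau> j - \<tau> (p + Suc k)) * poly P1 (\<tau> j)) / d"
      by (simp add: P_def algebra_simps flip: add_divide_distrib diff_divide_distrib)
    consider "j = p" | "j = p + Suc k" | "j \<in> {Suc p..p + k}" using j by fastforce
    then show ?thesis
    proof cases
      case 1
      then have "poly P (\<tau> j) = d * g (\<tau> j) / d" using P P1(3)[of p] by (simp add: d_def algebra_simps)
      then show ?thesis using d by simp
    next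
      case 2
      then show ?thesis using P d P2(3)[of "p + Suc k"] by (simp add: d_def)
    next
      case 3
      then have "poly P1 (\<tau> j) = g (\<tau> j)" "poly P2 (\<tau> j) = g (\<tau> j)"
        using P1(3)[of j] P2(3)[of j] by auto
      then have "poly P (\<tau> j) = d * g (\<tau> j) / d" using P by (simp add: d_def algebra_simps)
      then show ?thesis using d by simp
    qed
  qed
  ultimately show ?case by blast
qed

lemma divided_diff_mean_value:
  fixes g :: "nat \<Rightarrow> real \<Rightarrow> real"
  assumes der: "\<And>k t. k < n \<Longrightarrow> t \<in> {s..e} \<Longrightarrow>
      (g k has_real_derivative g (Suc k) t) (at t within {s..e})"
    and nodes: "inj_on \<tau> {..n}" "\<And>p. p \<le> n \<Longrightarrow> \<tau> p \<in> {s..e}"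
  shows "\<exists>\<zeta>\<in>{s..e}. divided_diff (g 0) \<tau> 0 n = g n \<zeta> / fact n"
proof -
  have "inj_on \<tau> {0..0 + n}" using nodes(1) by (simp add: atLeast0AtMost)
  from divided_diff_interpolant[OF this, of "g 0"] obtain P where
    P: "degree P \<le> n" "coeff P n = divided_diff (g 0) \<tau> 0 n"
      "\<And>j. j \<le> n \<Longrightarrow> poly P (\<tau> j) = g 0 (\<tau> j)" by auto
  have card: "card (\<tau> ` {..n}) = Suc n" using nodes(1) by (simp add: card_image)
  have "\<exists>\<zeta>\<in>{s..e}. g n \<zeta> = fact n * coeff P n"
    by (rule derivative_eq_interpolant_coeff[where X = "\<tau> ` {..n}"]) (use der card P nodes(2) in auto)
  then show ?thesis using P(2) by (auto intro!: bexI)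
qed

lemma lagrange_interp_diff:
  "lagrange_interp n \<tau> g t - lagrange_interp n \<tau> h t = lagrange_interp n \<tau> (\<lambda>u. g u - h u) t"
  by (simp add: lagrange_interp_def scaleR_diff_right sum_subtractf)

lemma lagrange_interp_nth:
  fixes g :: "real \<Rightarrow> real ^ 'd"
  shows "lagrange_interp n \<tau> g t $ c = lagrange_interp n \<tau> (\<lambda>u. g u $ c) t"
  by (simp add: lagrange_interp_def)

lemma divided_diff_nth:
  fixes g :: "real \<Rightarrow> real ^ 'd"
  shows "divided_diff g \<tau> p k $ c = divided_diff (\<lambda>u. g u $ c) \<tau> p k"
  by (induction k arbitrary: p) simp_all

lemma divided_diff_diff:
  "divided_diff g \<tau> p k - divided_diff h \<tau> p k = divided_diff (\<lambda>u. g u - h u) \<tau> p k"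
proof (induction k arbitrary: p)
  case (Suc k)
  show ?case by (simp add: Suc[symmetric] algebra_simps)
qed simp

lemma continuous_on_lagrange_interp:
  fixes g :: "real \<Rightarrow> 'b::real_normed_vector"
  shows "continuous_on S (lagrange_interp n \<tau> g)"
  unfolding lagrange_interp_def divide_inverse by (intro continuous_intros)

section \<open>Stability on well spaced nodes\<close>

text \<open>The common feature of the method nodes and of the auxiliary nodes: distinct nodes are at least
  the \<open>r\<close>-th part of the interval apart. It bounds Lagrange interpolation independently of the length of
  the interval.\<close>
definition spaced_nodes :: "nat \<Rightarrow> nat \<Rightarrow> real \<Rightarrow> real \<Rightarrow> (nat \<Rightarrow> real) \<Rightarrow> bool" where
  "spaced_nodes r n s e \<tau> \<longleftrightarrow>
     (\<forall>p<n. \<tau> p \<in> {s..e}) \<and> (\<forall>p<n. \<forall>q<n. p \<noteq> q \<longrightarrow> e - s \<le> real r * \<bar>\<tau> p - \<tau> q\<bar>)"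

lemma spaced_nodes_inj_on:
  assumes "spaced_nodes r n s e \<tau>" "s < e"
  shows "inj_on \<tau> {..<n}"
proof (rule inj_onI, rule ccontr)
  fix p q assume *: "p \<in> {..<n}" "q \<in> {..<n}" and "\<tau> p = \<tau> q" "p \<noteq> q"
  from * \<open>p \<noteq> q\<close> have "e - s \<le> real r * \<bar>\<tau> p - \<tau> q\<bar>"
    using assms(1) by (simp add: spaced_nodes_def)
  with \<open>\<tau> p = \<tau> q\<close> assms(2) show False by simp
qed

lemma spaced_method_nodes:
  assumes "s < e" "r \<ge> 1"
  shows "spaced_nodes r r s e (method_nodes r s e)"
proof (cases "r = 1")
  case True
  then show ?thesis using assms by (auto simp: spaced_nodes_def method_nodes_def)
next
  case False
  then have r: "real r - 1 > 0" using assms(2) by simp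
  have "method_nodes r s e p \<in> {s..e}" if "p < r" for p
  proof -
    have "real p \<le> real r - 1" using that by linarith
    then have "real p * (e - s) \<le> (real r - 1) * (e - s)" using assms(1) by (intro mult_right_mono) auto
    then have "real p * (e - s) / (real r - 1) \<le> e - s" using r by (simp add: field_simps)
    then show ?thesis using False r assms(1) by (simp add: method_nodes_def)
  qed
  moreover have "e - s \<le> real r * \<bar>method_nodes r s e p - method_nodes r s e q\<bar>" if "p \<noteq> q" for p q
  proof -
    have "method_nodes r s e p - method_nodes r s e q = (real p - real q) * ((e - s) / (real r - 1))"
      using False by (simp add: method_nodes_def left_diff_distrib flip: diff_divide_distrib)
    moreover have "\<bar>real p - real q\<bar> \<ge> 1" using that by linarith
    ultimately have "\<bar>method_nodes r s e p - method_nodes r s e q\<bar> \<ge> 1 * ((e - s) / (real r - 1))"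
      using r assms(1) by (simp only: abs_mult) (intro mult_mono, auto)
    then have "real r * \<bar>method_nodes r s e p - method_nodes r s e q\<bar> \<ge> (real r - 1) * ((e - s) / (real r - 1))"
      using r assms(1) by (intro mult_mono) auto
    then show ?thesis using r by simp
  qed
  ultimately show ?thesis by (simp add: spaced_nodes_def)
qed

lemma spaced_aux_nodes:
  assumes "s < e" "r \<ge> 1" "n \<le> Suc r"
  shows "spaced_nodes r n s e (aux_nodes r s e)"
proof -
  have "aux_nodes r s e p \<in> {s..e}" if "p < n" for p
  proof -
    have "real p * (e - s) \<le> real r * (e - s)" using assms that by (intro mult_right_mono) auto
    then have "real p * (e - s) / real r \<le> e - s" using assms by (simp add: divide_le_eq mult.commute)
    then show ?thesis using assms by (simp add: aux_nodes_def)
  qed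
  moreover have "e - s \<le> real r * \<bar>aux_nodes r s e p - aux_nodes r s e q\<bar>" if "p \<noteq> q" for p q
  proof -
    have "aux_nodes r s e p - aux_nodes r s e q = (real p - real q) * (e - s) / real r"
      by (simp add: aux_nodes_def diff_divide_distrib left_diff_distrib)
    then have "real r * \<bar>aux_nodes r s e p - aux_nodes r s e q\<bar> = \<bar>real p - real q\<bar> * (e - s)"
      using assms by (simp add: abs_mult)
    moreover have "\<bar>real p - real q\<bar> \<ge> 1" using that by linarith
    ultimately show ?thesis using assms(1) mult_right_mono[of 1 "\<bar>real p - real q\<bar>" "e - s"] by simp
  qed
  ultimately show ?thesis by (simp add: spaced_nodes_def)
qed

text \<open>A crude upper bound for the Lebesgue constant: there are \<open>r\<close> basis polynomials, each a product
  of fewer than \<open>r\<close> factors of modulus at most \<open>r\<close>.\<close>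
definition lebesgue_bound :: "nat \<Rightarrow> real" where
  "lebesgue_bound r = real r * real r ^ r"

lemma lebesgue_bound_ge_1: "r \<ge> 1 \<Longrightarrow> lebesgue_bound r \<ge> 1"
  using mult_mono[of 1 "real r" 1 "real r ^ r"] one_le_power[of "real r" r]
  by (simp add: lebesgue_bound_def)

lemma norm_lagrange_interp_le:
  fixes g :: "real \<Rightarrow> 'b::real_normed_vector"
  assumes "spaced_nodes r r s e \<tau>" "s < e" "r \<ge> 1" "u \<in> {s..e}"
    and \<epsilon>: "\<And>v. v \<in> {s..e} \<Longrightarrow> norm (g v) \<le> \<epsilon>"
  shows "norm (lagrange_interp r \<tau> g u) \<le> lebesgue_bound r * \<epsilon>"
proof -
  have "\<bar>(\<Prod>q\<in>{..<r} - {p}. (u - \<tau> q) / (\<tau> p - \<tau> q))\<bar> \<le> real r ^ r" if p: "p < r" for p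
  proof -
    have "\<bar>(u - \<tau> q) / (\<tau> p - \<tau> q)\<bar> \<le> real r" if q: "q \<in> {..<r} - {p}" for q
    proof -
      have sp: "e - s \<le> real r * \<bar>\<tau> p - \<tau> q\<bar>" "\<tau> q \<in> {s..e}"
        using p q assms(1) by (auto simp: spaced_nodes_def)
      then have "\<bar>u - \<tau> q\<bar> \<le> real r * \<bar>\<tau> p - \<tau> q\<bar>" using assms(4) by auto
      moreover have "\<bar>\<tau> p - \<tau> q\<bar> > 0" using sp(1) assms(2) by (cases "\<tau> p = \<tau> q") auto
      ultimately show ?thesis by (simp add: divide_le_eq)
    qed
    then have "\<bar>(\<Prod>q\<in>{..<r} - {p}. (u - \<tau> q) / (\<tau> p - \<tau> q))\<bar> \<le> (\<Prod>q\<in>{..<r} - {p}. real r)"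
      unfolding abs_prod by (intro prod_mono) auto
    also have "\<dots> \<le> real r ^ r" using assms(3) using card_Diff1_le[of "{..<r}" p] by (auto intro!: power_increasing)
    finally show ?thesis .
  qed
  then have "norm (lagrange_interp r \<tau> g u) \<le> (\<Sum>p<r. real r ^ r * \<epsilon>)"
    unfolding lagrange_interp_def using assms(1) \<epsilon>
    by (intro sum_norm_le) (auto simp: spaced_nodes_def intro!: mult_mono)
  then show ?thesis by (simp add: lebesgue_bound_def)
qed

text \<open>The loss of \<open>k\<close> powers of the length is what an error of order \<open>k + 1\<close> in \<open>g\<close> compensates.\<close>
lemma norm_divided_diff_le:
  fixes g :: "real \<Rightarrow> 'b::real_normed_vector"
  assumes sp: "spaced_nodes r n s e \<tau>" and "s < e" "r \<ge> 1" "p + k < n"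
    and \<epsilon>: "\<And>v. v \<in> {s..e} \<Longrightarrow> norm (g v) \<le> \<epsilon>"
  shows "norm (divided_diff g \<tau> p k) \<le> (2 * real r / (e - s)) ^ k * \<epsilon>"
  using assms(4)
proof (induction k arbitrary: p)
  case 0
  then show ?case using sp \<epsilon> by (simp add: spaced_nodes_def)
next
  case (Suc k)
  let ?d = "\<tau> (p + Suc k) - \<tau> p" and ?B = "(2 * real r / (e - s)) ^ k * \<epsilon>"
  have d: "e - s \<le> real r * \<bar>?d\<bar>" using sp Suc.prems by (auto simp: spaced_nodes_def)
  then have d0: "\<bar>?d\<bar> > 0" using assms(2) by (cases "?d = 0") auto
  have "1 / \<bar>?d\<bar> \<le> real r / (e - s)" using d d0 assms(2) by (simp add: field_simps)
  moreover have "norm (divided_diff g \<tau> (Suc p) k - divided_diff g \<tau> p k) \<le> ?B + ?B"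
    using Suc.prems by (intro order_trans[OF norm_triangle_ineq4] add_mono Suc.IH) auto
  ultimately have "1 / \<bar>?d\<bar> * norm (divided_diff g \<tau> (Suc p) k - divided_diff g \<tau> p k)
      \<le> real r / (e - s) * (?B + ?B)"
    using assms(2) by (intro mult_mono) auto
  moreover have "real r / (e - s) * (?B + ?B) = (2 * real r / (e - s)) ^ Suc k * \<epsilon>" by simp
  ultimately show ?case by (simp del: power_Suc)
qed

section \<open>Local existence and the integral form of solutions\<close>

text \<open>The auxiliary interval may reach beyond the mesh interval, where no local solution is given, so
  one has to be constructed: the Picard operator is a contraction on the bounded continuous
  functions. Functions on the whole line are used, with the time argument clamped to the interval.\<close>
lemma lipschitz_ivp_has_solution:
  fixes f :: "real \<Rightarrow> real ^ 'd \<Rightarrow> real ^ 'd"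
  assumes "s \<le> e" and cont: "continuous_on ({s..e} \<times> UNIV) (\<lambda>(t, y). f t y)"
    and lip: "\<And>t y y'. t \<in> {s..e} \<Longrightarrow> norm (f t y - f t y') \<le> L * norm (y - y')"
    and "0 \<le> L" and small: "L * (e - s) < 1"
  shows "\<exists>w. ivp_solution f s e y w"
proof -
  define I where "I u t = integral {s..t} (\<lambda>v. f v (u v))" for u t
  (* The clamp extends the operator beyond {s..e} by constants, which keeps its values bounded. *)
  define cl where "cl t = min e (max s t)" for t :: real
  define \<Phi> where "\<Phi> u = Bcontfun (\<lambda>t. y + I (apply_bcontfun u) (cl t))" for u
  have cl: "cl t \<in> {s..e}" for t using \<open>s \<le> e\<close> by (auto simp: cl_def)
  have contf: "continuous_on {s..e} (\<lambda>v. f v (u v))" if "continuous_on {s..e} u" for u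
  proof -
    have "continuous_on {s..e} (\<lambda>v. (v, u v))" using that by (intro continuous_intros)
    from continuous_on_compose2[OF cont this] show ?thesis by auto
  qed
  have contI: "continuous_on {s..e} (\<lambda>t. y + I u t)" if "continuous_on {s..e} u" for u
    unfolding I_def using contf[OF that]
    by (intro continuous_intros indefinite_integral_continuous_1 integrable_continuous_real)
  have "(\<lambda>t. y + I (apply_bcontfun u) (cl t)) \<in> bcontfun" for u
  proof -
    have c: "continuous_on {s..e} (\<lambda>t. y + I (apply_bcontfun u) t)"
      by (intro contI) simp
    have "continuous_on UNIV (\<lambda>t. y + I (apply_bcontfun u) (cl t))"
      by (rule continuous_on_compose2[OF c]) (use cl in \<open>auto simp: cl_def intro!: continuous_intros\<close>)
    moreover have "bounded (range (\<lambda>t. y + I (apply_bcontfun u) (cl t)))"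
      by (rule bounded_subset[OF compact_imp_bounded[OF compact_continuous_image[OF c]]]) (use cl in auto)
    ultimately show ?thesis by (simp add: bcontfun_def)
  qed
  then have \<Phi>: "apply_bcontfun (\<Phi> u) = (\<lambda>t. y + I (apply_bcontfun u) (cl t))" for u
    unfolding \<Phi>_def by (rule Bcontfun_inverse)
  have "dist (\<Phi> u) (\<Phi> v) \<le> (L * (e - s)) * dist u v" for u v
  proof (rule dist_bound)
    fix t
    have sub: "{s..cl t} \<subseteq> {s..e}" using cl[of t] by auto
    have cu: "continuous_on {s..cl t} (\<lambda>\<tau>. f \<tau> (apply_bcontfun u \<tau>))" for u
      by (rule continuous_on_subset[OF contf sub]) simp
    have "norm (integral {s..cl t} (\<lambda>\<tau>. f \<tau> (apply_bcontfun u \<tau>) - f \<tau> (apply_bcontfun v \<tau>)))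
        \<le> (L * dist u v) * (cl t - s)"
    proof (rule integral_bound)
      fix \<tau> assume "\<tau> \<in> {s..cl t}"
      then have "norm (f \<tau> (apply_bcontfun u \<tau>) - f \<tau> (apply_bcontfun v \<tau>))
          \<le> L * dist (apply_bcontfun u \<tau>) (apply_bcontfun v \<tau>)"
        using lip sub by (auto simp: dist_norm)
      also have "\<dots> \<le> L * dist u v" using \<open>0 \<le> L\<close> dist_bounded by (intro mult_left_mono)
      finally show "norm (f \<tau> (apply_bcontfun u \<tau>) - f \<tau> (apply_bcontfun v \<tau>)) \<le> L * dist u v" .
    qed (use cl[of t] cu in \<open>auto intro: continuous_on_diff\<close>)
    also have "\<dots> \<le> (L * dist u v) * (e - s)" using cl[of t] \<open>0 \<le> L\<close> by (intro mult_left_mono) auto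
    finally show "dist (apply_bcontfun (\<Phi> u) t) (apply_bcontfun (\<Phi> v) t) \<le> (L * (e - s)) * dist u v"
      using cu by (simp add: \<Phi> I_def dist_norm integral_diff integrable_continuous_real algebra_simps)
  qed
  then obtain u where u: "\<Phi> u = u"
    using banach_fix_type[of "L * (e - s)" \<Phi>] small \<open>0 \<le> L\<close> \<open>s \<le> e\<close> by auto
  define w where "w = apply_bcontfun u"
  have w: "w t = y + I w t" if "t \<in> {s..e}" for t
  proof -
    have "w t = y + I w (cl t)" unfolding w_def by (metis \<Phi> u)
    then show ?thesis using that by (simp add: cl_def)
  qed
  have "ivp_solution f s e y w"
    unfolding ivp_solution_def
  proof (intro conjI ballI)
    show "w s = y" using w[of s] \<open>s \<le> e\<close> by (simp add: I_def)
    fix t assume t: "t \<in> {s..e}"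
    have "continuous_on {s..e} w" unfolding w_def by simp
    from integral_has_vector_derivative[OF contf[OF this] t]
    have "((\<lambda>t. y + I w t) has_vector_derivative f t (w t)) (at t within {s..e})"
      unfolding I_def by (auto intro!: derivative_eq_intros)
    then show "(w has_vector_derivative f t (w t)) (at t within {s..e})"
      by (rule has_vector_derivative_transform_within[OF _ zero_less_one t]) (use w in auto)
  qed
  then show ?thesis by blast
qed

lemma ivp_solution_subinterval:
  assumes "ivp_solution f s e y w" "s \<le> s'" "e' \<le> e"
  shows "ivp_solution f s' e' (w s') w"
  using assms unfolding ivp_solution_def
  by (auto intro: has_vector_derivative_within_subset[where S = "{s..e}"])

lemma ivp_solution_has_integral:
  assumes "ivp_solution f s e y w" "t \<in> {s..e}"
  shows "((\<lambda>u. f u (w u)) has_integral (w t - y)) {s..t}"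
proof -
  have "((\<lambda>u. f u (w u)) has_integral (w t - w s)) {s..t}"
    using assms ivp_solution_subinterval[OF assms(1), of s t]
    by (intro fundamental_theorem_of_calculus) (auto simp: ivp_solution_def)
  then show ?thesis using assms(1) by (simp add: ivp_solution_def)
qed

lemma ivp_solution_continuous_on: "ivp_solution f s e y w \<Longrightarrow> continuous_on {s..e} w"
  unfolding ivp_solution_def
  by (auto simp: continuous_on_eq_continuous_within intro: has_vector_derivative_continuous)

section \<open>Error propagation through the iteration\<close>
lemma solution_minus_iterate_has_integral:
  assumes "ivp_solution f s e y w" "t \<in> {s..e}"
  shows "((\<lambda>u. f u (w u) - lagrange_interp r \<tau> (\<lambda>u. f u (interp_iter f r \<tau> s y' j u)) u) has_integral
     ((w t - interp_iter f r \<tau> s y' (Suc j) t) - (y - y'))) {s..t}"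
proof -
  have "(lagrange_interp r \<tau> (\<lambda>u. f u (interp_iter f r \<tau> s y' j u)) has_integral
      (interp_iter f r \<tau> s y' (Suc j) t - y')) {s..t}"
    by (simp add: integrable_integral integrable_continuous_real continuous_on_lagrange_interp)
  from has_integral_diff[OF ivp_solution_has_integral[OF assms] this]
  show ?thesis by (simp add: algebra_simps)
qed

lemma lagrange_interp_lipschitz:
  fixes f :: "real \<Rightarrow> real ^ 'd \<Rightarrow> real ^ 'd"
  assumes nodes: "spaced_nodes r r s e \<tau>" "s < e" "r \<ge> 1"
    and lip: "\<And>t y y'. t \<in> {s..e} \<Longrightarrow> norm (f t y - f t y') \<le> L * norm (y - y')" and "0 \<le> L"
    and d: "\<And>u. u \<in> {s..e} \<Longrightarrow> norm (w u - v u) \<le> d" and "u \<in> {s..e}"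
  shows "norm (lagrange_interp r \<tau> (\<lambda>u. f u (w u)) u - lagrange_interp r \<tau> (\<lambda>u. f u (v u)) u)
    \<le> lebesgue_bound r * (L * d)"
  unfolding lagrange_interp_diff
proof (rule norm_lagrange_interp_le[OF nodes \<open>u \<in> {s..e}\<close>])
  fix x assume x: "x \<in> {s..e}"
  show "norm (f x (w x) - f x (v x)) \<le> L * d"
    using lip[OF x] d[OF x] \<open>0 \<le> L\<close> by (meson mult_left_mono order_trans)
qed

text \<open>The integrand splits into the interpolation error along the exact solution and the interpolant
  of a difference, which the Lebesgue and Lipschitz constants control. The starting values may differ,
  so that the estimate serves both the local and the global error.\<close>
lemma picard_interp_step:
  fixes f :: "real \<Rightarrow> real ^ 'd \<Rightarrow> real ^ 'd"
  assumes sol: "ivp_solution f s e y w" and nodes: "spaced_nodes r r s e \<tau>" "s < e" "r \<ge> 1"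
    and lip: "\<And>t y y'. t \<in> {s..e} \<Longrightarrow> norm (f t y - f t y') \<le> L * norm (y - y')" and "0 \<le> L"
    and E: "\<And>u. u \<in> {s..e} \<Longrightarrow> norm (f u (w u) - lagrange_interp r \<tau> (\<lambda>u. f u (w u)) u) \<le> E"
    and d: "\<And>u. u \<in> {s..e} \<Longrightarrow> norm (w u - interp_iter f r \<tau> s y' j u) \<le> d"
    and t: "t \<in> {s..e}"
  shows "norm (w t - interp_iter f r \<tau> s y' (Suc j) t)
    \<le> norm (y - y') + (e - s) * (E + lebesgue_bound r * L * d)"
proof -
  let ?l = "interp_iter f r \<tau> s y'"
  let ?P = "lagrange_interp r \<tau>" and ?B = "E + lebesgue_bound r * (L * d)"
  have bd: "norm (f u (w u) - ?P (\<lambda>u. f u (?l j u)) u) \<le> ?B" if u: "u \<in> {s..e}" for u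
    proof -
    have "norm (?P (\<lambda>u. f u (w u)) u - ?P (\<lambda>u. f u (?l j u)) u) \<le> lebesgue_bound r * (L * d)"
      using lagrange_interp_lipschitz[of r s e \<tau> f L w "?l j" d u] nodes lip \<open>0 \<le> L\<close> d u by blast
    from norm_triangle_mono[OF E[OF u] this] show ?thesis by simp
  qed
  have B0: "0 \<le> ?B" using order_trans[OF norm_ge_zero bd[OF t]] .
  have "norm ((w t - ?l (Suc j) t) - (y - y')) \<le> ?B * (t - s)"
    using has_integral_bound_real[OF B0 finite.emptyI solution_minus_iterate_has_integral[OF sol t]] bd t
    by auto
  also have "\<dots> \<le> ?B * (e - s)" using t B0 by (intro mult_left_mono) auto
  finally have "norm ((w t - ?l (Suc j) t) - (y - y')) \<le> (e - s) * (E + lebesgue_bound r * L * d)"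
    by (simp add: mult_ac)
  then show ?thesis using norm_triangle_sub[of "w t - ?l (Suc j) t" "y - y'"] by linarith
qed

text \<open>A version for one component, in which only the interpolation error has to be
  known componentwise: the second part of the integrand is of higher order, and its norm may be used.\<close>
lemma picard_interp_component_error:
  fixes f :: "real \<Rightarrow> real ^ 'd \<Rightarrow> real ^ 'd"
  assumes sol: "ivp_solution f s e y w" and nodes: "spaced_nodes r r s e \<tau>" "s < e" "r \<ge> 1"
    and lip: "\<And>t y y'. t \<in> {s..e} \<Longrightarrow> norm (f t y - f t y') \<le> L * norm (y - y')" and "0 \<le> L"
    and A: "\<And>u. u \<in> {s..e} \<Longrightarrow> \<bar>(f u (w u) - lagrange_interp r \<tau> (\<lambda>u. f u (w u)) u) $ c\<bar> \<le> A"
    and d: "\<And>u. u \<in> {s..e} \<Longrightarrow> norm (w u - interp_iter f r \<tau> s y j u) \<le> d"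
    and t: "t \<in> {s..e}"
  shows "\<bar>(w t - interp_iter f r \<tau> s y (Suc j) t) $ c\<bar>
    \<le> (e - s) * (A + lebesgue_bound r * L * d)"
proof -
  let ?l = "interp_iter f r \<tau> s y"
  let ?P = "lagrange_interp r \<tau>" and ?B = "A + lebesgue_bound r * (L * d)"
  have bd: "\<bar>(f u (w u) - ?P (\<lambda>u. f u (?l j u)) u) $ c\<bar> \<le> ?B" if u: "u \<in> {s..e}" for u
  proof -
    have "\<bar>(?P (\<lambda>u. f u (w u)) u - ?P (\<lambda>u. f u (?l j u)) u) $ c\<bar> \<le> lebesgue_bound r * (L * d)"
      by (rule order_trans[OF component_le_norm_cart],
          rule lagrange_interp_lipschitz[OF nodes lip \<open>0 \<le> L\<close> d u])
    then show ?thesis using A[OF u] by simp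
  qed
  have B0: "0 \<le> ?B" using order_trans[OF abs_ge_zero bd[OF t]] .
  have "((\<lambda>u. (f u (w u) - ?P (\<lambda>u. f u (?l j u)) u) $ c) has_integral (w t - ?l (Suc j) t) $ c) {s..t}"
    using has_integral_linear[OF solution_minus_iterate_has_integral[OF sol t, where y' = y] bounded_linear_vec_nth]
    by (simp add: o_def del: interp_iter.simps)
  from has_integral_bound_real[OF B0 finite.emptyI this]
  have "\<bar>(w t - ?l (Suc j) t) $ c\<bar> \<le> ?B * (t - s)" using bd t by (auto simp del: interp_iter.simps)
  also have "\<dots> \<le> ?B * (e - s)" using t B0 by (intro mult_left_mono) auto
  finally show ?thesis by (simp add: mult_ac)
qed

lemma picard_interp_local_error:
  fixes f :: "real \<Rightarrow> real ^ 'd \<Rightarrow> real ^ 'd"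
  assumes sol: "ivp_solution f s e y w" and nodes: "spaced_nodes r r s e \<tau>" "s < e" "r \<ge> 1"
    and lip: "\<And>t y y'. t \<in> {s..e} \<Longrightarrow> norm (f t y - f t y') \<le> L * norm (y - y')" and "0 \<le> L"
    and E: "\<And>u. u \<in> {s..e} \<Longrightarrow> norm (f u (w u) - lagrange_interp r \<tau> (\<lambda>u. f u (w u)) u) \<le> E"
    and B: "\<And>u. u \<in> {s..e} \<Longrightarrow> norm (w u - y) \<le> B * (e - s)"
    and small: "lebesgue_bound r * L * (e - s) \<le> 1"
    and t: "t \<in> {s..e}"
  shows "norm (w t - interp_iter f r \<tau> s y j t)
    \<le> B * (lebesgue_bound r * L) ^ j * (e - s) ^ Suc j + real j * (e - s) * E"
  using t
proof (induction j arbitrary: t)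
  case 0
  then show ?case using B by simp
next
  case (Suc j)
  let ?c = "lebesgue_bound r * L" and ?h = "e - s"
  have E0: "0 \<le> E" using order_trans[OF norm_ge_zero E[OF Suc.prems]] .
  have "norm (w t - interp_iter f r \<tau> s y (Suc j) t)
      \<le> norm (y - y) + ?h * (E + ?c * (B * ?c ^ j * ?h ^ Suc j + real j * ?h * E))"
    by (rule picard_interp_step[OF sol nodes lip \<open>0 \<le> L\<close> E Suc.IH Suc.prems])
  also have "\<dots> = B * ?c ^ Suc j * ?h ^ Suc (Suc j) + ?h * E + (?c * ?h) * (real j * ?h * E)"
    by (simp add: algebra_simps)
  also have "(?c * ?h) * (real j * ?h * E) \<le> real j * ?h * E"
    using small E0 \<open>s < e\<close> by (intro mult_left_le_one_le) (auto simp: lebesgue_bound_def \<open>0 \<le> L\<close>)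
  finally show ?case by (simp add: algebra_simps del: interp_iter.simps)
qed

text \<open>Used to compare the method with the exact solution, which passes near but not through the value
  \<open>y'\<close>. A bound that all iterates share suffices, since convergence of any order keeps the method in the
  tube.\<close>
lemma picard_interp_perturbed_error:
  fixes f :: "real \<Rightarrow> real ^ 'd \<Rightarrow> real ^ 'd"
  assumes sol: "ivp_solution f s e y w" and nodes: "spaced_nodes r r s e \<tau>" "s < e" "r \<ge> 1"
    and lip: "\<And>t y y'. t \<in> {s..e} \<Longrightarrow> norm (f t y - f t y') \<le> L * norm (y - y')" and "0 \<le> L"
    and E: "\<And>u. u \<in> {s..e} \<Longrightarrow> norm (f u (w u) - lagrange_interp r \<tau> (\<lambda>u. f u (w u)) u) \<le> E"
    and B: "\<And>u. u \<in> {s..e} \<Longrightarrow> norm (w u - y) \<le> B * (e - s)"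
    and small: "lebesgue_bound r * L * (e - s) \<le> 1 / 2"
    and t: "t \<in> {s..e}"
  shows "norm (w t - interp_iter f r \<tau> s y' j t) \<le> 2 * norm (y - y') + (e - s) * (2 * E + B)"
  using t
proof (induction j arbitrary: t)
  case 0
  have E0: "0 \<le> (e - s) * E" using order_trans[OF norm_ge_zero E[OF 0]] \<open>s < e\<close> by simp
  have "norm (w t - y') \<le> B * (e - s) + norm (y - y')"
    using norm_triangle_mono[OF B[OF 0] order_refl, of "y - y'"] by simp
  moreover have "B * (e - s) + norm (y - y') \<le> 2 * norm (y - y') + (e - s) * (2 * E + B)"
  proof -
    have "2 * norm (y - y') + (e - s) * (2 * E + B)
        = B * (e - s) + norm (y - y') + (norm (y - y') + 2 * ((e - s) * E))"
      by (simp add: algebra_simps)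
    then show ?thesis using E0 norm_ge_zero[of "y - y'"] by linarith
  qed
  ultimately show ?case by simp
next
  case (Suc j)
  let ?c = "lebesgue_bound r * L" and ?h = "e - s"
  let ?d = "2 * norm (y - y') + ?h * (2 * E + B)"
  have E0: "0 \<le> E" using order_trans[OF norm_ge_zero E[OF Suc.prems]] .
  have B0: "0 \<le> ?h * B" using order_trans[OF norm_ge_zero B[OF Suc.prems]] by (simp add: mult.commute)
  have d0: "0 \<le> ?d" using order_trans[OF norm_ge_zero Suc.IH[OF Suc.prems]] .
  have "norm (w t - interp_iter f r \<tau> s y' (Suc j) t) \<le> norm (y - y') + ?h * (E + ?c * ?d)"
    by (rule picard_interp_step[OF sol nodes lip \<open>0 \<le> L\<close> E Suc.IH Suc.prems])
  also have "\<dots> = norm (y - y') + ?h * E + (?c * ?h) * ?d" by (simp add: algebra_simps)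
  also have "(?c * ?h) * ?d \<le> 1 / 2 * ?d" using small d0 by (rule mult_right_mono)
  also have "norm (y - y') + ?h * E + 1 / 2 * ?d \<le> ?d" using B0 by (simp add: algebra_simps)
  finally show ?case by (simp del: interp_iter.simps)
qed

section \<open>Uniform estimates in a tube around the solution\<close>
lemma mesh_bounds:
  assumes "mesh a b m x" "i \<le> m"
  shows "x i \<in> {a..b}"
proof -
  have inc: "x i \<le> x j" if "i \<le> j" "j \<le> m" for i j
    using that by (induction j rule: dec_induct)
      (use assms(1) in \<open>auto simp: mesh_def intro: order_trans[OF _ less_imp_le]\<close>)
  show ?thesis using inc[of 0 i] inc[of i m] assms by (auto simp: mesh_def)
qed

text \<open>What the class of right-hand sides provides, in the Euclidean norm: a region \<open>D\<close>, total
  derivatives \<open>F k\<close> of \<open>f\<close> on it, and one bound \<open>M\<close> for all of them.\<close>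
locale smooth_ivp =
  fixes f :: "real \<Rightarrow> real ^ 'd \<Rightarrow> real ^ 'd" and a b L M :: real and r :: nat
    and D :: "(real ^ 'd) set" and F :: "nat \<Rightarrow> real \<times> (real ^ 'd) \<Rightarrow> real ^ 'd"
  assumes r: "r \<ge> 1" and L: "0 \<le> L" and M0: "0 \<le> M"
    and cont: "continuous_on ({a..b} \<times> UNIV) (\<lambda>(t, y). f t y)"
    and lip: "\<And>t y y'. t \<in> {a..b} \<Longrightarrow> norm (f t y - f t y') \<le> L * norm (y - y')"
    and F_0: "\<And>t y. F 0 (t, y) = f t y"
    and F_Suc: "\<And>k x. k < r \<Longrightarrow> x \<in> {a..b} \<times> D \<Longrightarrow>
      \<exists>A. (F k has_derivative A) (at x within {a..b} \<times> D) \<and> F (Suc k) x = A (1, f (fst x) (snd x))"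
    and F_le: "\<And>k x. k \<le> r \<Longrightarrow> x \<in> {a..b} \<times> D \<Longrightarrow> norm (F k x) \<le> M"
begin

definition lip_factor :: real where
  "lip_factor = lebesgue_bound r * L"

definition remainder_const :: real where
  "remainder_const = real CARD('d) * M"

definition local_const :: real where
  "local_const = 2 * M * lip_factor ^ r + (real r + 1) * remainder_const"

definition global_const :: real where
  "global_const = remainder_const + lip_factor * (2 * remainder_const + 2 * M)"

lemma L_le_lip_factor: "L \<le> lip_factor"
  using mult_right_mono[OF lebesgue_bound_ge_1[OF r] L] by (simp add: lip_factor_def)

lemma lip_factor_nonneg: "0 \<le> lip_factor"
  using L L_le_lip_factor by simp

lemma remainder_const_nonneg: "0 \<le> remainder_const"
  using M0 by (simp add: remainder_const_def)

lemma F_component_derivative: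
  assumes sol: "ivp_solution f s e y w" and sub: "{s..e} \<subseteq> {a..b}" "w ` {s..e} \<subseteq> D"
    and k: "k < r" and t: "t \<in> {s..e}"
  shows "((\<lambda>t. F k (t, w t) $ c) has_real_derivative F (Suc k) (t, w t) $ c) (at t within {s..e})"
proof -
  have im: "(\<lambda>t. (t, w t)) ` {s..e} \<subseteq> {a..b} \<times> D" using sub by auto
  have "(t, w t) \<in> {a..b} \<times> D" using t sub by auto
  from F_Suc[OF k this] obtain A where
    A: "(F k has_derivative A) (at (t, w t) within {a..b} \<times> D)" "F (Suc k) (t, w t) = A (1, f t (w t))"
    by auto
  have "(w has_vector_derivative f t (w t)) (at t within {s..e})"
    using sol t by (simp add: ivp_solution_def)
  from derivative_along_integral_curve[where f = f and w = w and G = "F k", OF this t im A]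
  show ?thesis
    unfolding has_real_derivative_iff_has_vector_derivative
    by (rule bounded_linear.has_vector_derivative[OF bounded_linear_vec_nth])
qed

lemma interpolation_component_error:
  assumes sol: "ivp_solution f s e y w" and sub: "{s..e} \<subseteq> {a..b}" "w ` {s..e} \<subseteq> D"
    and nodes: "spaced_nodes r r s e \<tau>" "s < e"
    and A: "\<And>\<zeta>. \<zeta> \<in> {s..e} \<Longrightarrow> \<bar>F r (\<zeta>, w \<zeta>) $ c\<bar> \<le> A" and u: "u \<in> {s..e}"
  shows "\<bar>(f u (w u) - lagrange_interp r \<tau> (\<lambda>u. f u (w u)) u) $ c\<bar> \<le> A / fact r * (e - s) ^ r"
  using lagrange_interp_remainder[of r s e "\<lambda>k t. F k (t, w t) $ c" \<tau> u A]
    F_component_derivative[OF sol sub] r spaced_nodes_inj_on[OF nodes] nodes(1) u A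
  by (simp add: spaced_nodes_def lagrange_interp_nth F_0)

lemma interpolation_error:
  assumes sol: "ivp_solution f s e y w" and sub: "{s..e} \<subseteq> {a..b}" "w ` {s..e} \<subseteq> D"
    and nodes: "spaced_nodes r r s e \<tau>" "s < e" and u: "u \<in> {s..e}"
  shows "norm (f u (w u) - lagrange_interp r \<tau> (\<lambda>u. f u (w u)) u) \<le> remainder_const * (e - s) ^ r"
proof -
  let ?v = "f u (w u) - lagrange_interp r \<tau> (\<lambda>u. f u (w u)) u"
  have "\<bar>?v $ c\<bar> \<le> M * (e - s) ^ r" for c
  proof -
    have "\<bar>F r (\<zeta>, w \<zeta>) $ c\<bar> \<le> M" if "\<zeta> \<in> {s..e}" for \<zeta>
      by (rule order_trans[OF component_le_norm_cart F_le]) (use sub that in auto)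
    from interpolation_component_error[OF sol sub nodes this u]
    have "\<bar>?v $ c\<bar> \<le> M / fact r * (e - s) ^ r" by simp
    moreover have "M / fact r \<le> M" using M0 by (simp add: divide_le_eq mult_left_le mult_le_cancel_left1 fact_ge_1)
    ultimately show ?thesis using nodes(2) mult_right_mono[of "M / fact r" M "(e - s) ^ r"] by simp
  qed
  then have "norm ?v \<le> (\<Sum>c\<in>(UNIV :: 'd set). M * (e - s) ^ r)"
    by (intro order_trans[OF norm_le_l1_cart] sum_mono) blast
  then show ?thesis by (simp add: remainder_const_def)
qed

text \<open>Only the starting value has to lie in \<open>D\<close>: the growth of \<open>f\<close> away from it is controlled by the
  global Lipschitz condition, so the bound can be used to prove that the solution remains in \<open>D\<close>.\<close>
lemma solution_stays_close:
  assumes sol: "ivp_solution f s e y w" and sub: "{s..e} \<subseteq> {a..b}" and y: "y \<in> D"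
    and small: "L * (e - s) \<le> 1 / 2" and t: "t \<in> {s..e}"
  shows "norm (w t - y) \<le> 2 * M * (e - s)"
proof -
  have "continuous_on {s..e} (\<lambda>t. norm (w t - y))"
    using ivp_solution_continuous_on[OF sol] by (intro continuous_intros)
  then obtain u where u: "u \<in> {s..e}" "\<And>v. v \<in> {s..e} \<Longrightarrow> norm (w v - y) \<le> norm (w u - y)"
    using continuous_attains_sup[of "{s..e}" "\<lambda>t. norm (w t - y)"] t by auto
  let ?R = "norm (w u - y)"
  have "norm (f v (w v)) \<le> M + L * ?R" if v: "v \<in> {s..e}" for v
  proof -
    have v': "v \<in> {a..b}" using v sub by auto
    have "norm (f v y) \<le> M" using F_le[of 0 "(v, y)"] v' y by (simp add: F_0)
    moreover have "norm (f v (w v) - f v y) \<le> L * ?R"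
      using lip[OF v', of "w v" y] mult_left_mono[OF u(2)[OF v] L] by simp
    ultimately show ?thesis using norm_triangle_sub[of "f v (w v)" "f v y"] by simp
  qed
  moreover have "0 \<le> M + L * ?R" using M0 L by simp
  ultimately have "?R \<le> (M + L * ?R) * (u - s)"
    using has_integral_bound_real[OF _ finite.emptyI ivp_solution_has_integral[OF sol u(1)]] u(1) by auto
  also have "\<dots> \<le> (M + L * ?R) * (e - s)"
    using u(1) \<open>0 \<le> M + L * ?R\<close> by (intro mult_left_mono) auto
  also have "\<dots> = M * (e - s) + (L * (e - s)) * ?R" by (simp add: algebra_simps)
  also have "(L * (e - s)) * ?R \<le> 1 / 2 * ?R" using small by (rule mult_right_mono) simp
  finally have "?R \<le> 2 * M * (e - s)" by simp
  then show ?thesis using u(2)[OF t] by simp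
qed

text \<open>The case \<open>j = r\<close> is used for the method, where one more sweep is analysed separately, and
  \<open>j = r + 1\<close> for the auxiliary approximation.\<close>
lemma iterate_local_error:
  assumes sol: "ivp_solution f s e y w" and sub: "{s..e} \<subseteq> {a..b}" "w ` {s..e} \<subseteq> D"
    and nodes: "spaced_nodes r r s e \<tau>" "s < e"
    and small: "lip_factor * (e - s) \<le> 1 / 2" and j: "r \<le> j" "j \<le> r + 1" and t: "t \<in> {s..e}"
  shows "norm (w t - interp_iter f r \<tau> s y j t) \<le> local_const * (e - s) ^ (r + 1)"
proof -
  let ?h = "e - s"
  have h: "0 \<le> ?h" using nodes(2) by simp
  have smallL: "L * ?h \<le> 1 / 2" using mult_right_mono[OF L_le_lip_factor h] small by simp
  have y: "w s = y" "y \<in> D" using sol sub(2) nodes(2) by (auto simp: ivp_solution_def)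
  have lip': "norm (f t y - f t y') \<le> L * norm (y - y')" if "t \<in> {s..e}" for t y y'
    using lip that sub(1) by blast
  have small': "lebesgue_bound r * L * ?h \<le> 1" using small by (simp add: lip_factor_def)
  have "norm (w t - interp_iter f r \<tau> s y j t)
      \<le> 2 * M * lip_factor ^ j * ?h ^ Suc j + real j * ?h * (remainder_const * ?h ^ r)"
    unfolding lip_factor_def
    by (rule picard_interp_local_error[OF sol nodes r lip' L interpolation_error[OF sol sub nodes]
          solution_stays_close[OF sol sub(1) y(2) smallL] small' t])
  moreover have "lip_factor ^ j * ?h ^ Suc j \<le> lip_factor ^ r * ?h ^ (r + 1)"
  proof -
    (* For j = r + 1 one factor lip_factor * h is given away, to have one bound for both j. *)
    have "(lip_factor * ?h) ^ j \<le> (lip_factor * ?h) ^ r"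
      using small j(1) lip_factor_nonneg h by (intro power_decreasing) auto
    from mult_right_mono[OF this h] show ?thesis by (simp add: power_mult_distrib mult_ac)
  qed
  then have "2 * M * lip_factor ^ j * ?h ^ Suc j \<le> 2 * M * lip_factor ^ r * ?h ^ (r + 1)"
    using mult_left_mono[of _ _ "2 * M"] M0 by (simp add: mult.assoc)
  moreover have "real j * ?h * (remainder_const * ?h ^ r) \<le> (real r + 1) * remainder_const * ?h ^ (r + 1)"
  proof -
    have "real j * (remainder_const * ?h ^ (r + 1)) \<le> (real r + 1) * (remainder_const * ?h ^ (r + 1))"
      using j(2) remainder_const_nonneg h by (intro mult_right_mono) auto
    then show ?thesis by (simp add: mult_ac)
  qed
  ultimately show ?thesis by (simp add: local_const_def algebra_simps)
qed

lemma method_value_step: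
  assumes sol: "ivp_solution f s e y w" and sub: "{s..e} \<subseteq> {a..b}" "w ` {s..e} \<subseteq> D"
    and "s < e" "e - s \<le> H" "H \<le> 1" and small: "lip_factor * H \<le> 1 / 2"
  shows "norm (w e - local_approx f r s e y' e)
    \<le> (1 + 2 * lip_factor * (e - s)) * norm (y - y') + (e - s) * (global_const * H)"
proof -
  let ?h = "e - s" and ?\<tau> = "method_nodes r s e"
  have nodes: "spaced_nodes r r s e ?\<tau>" using spaced_method_nodes[OF \<open>s < e\<close> r] .
  have h: "0 \<le> ?h" using \<open>s < e\<close> by simp
  have "lip_factor * ?h \<le> lip_factor * H" using \<open>?h \<le> H\<close> lip_factor_nonneg by (rule mult_left_mono)
  then have small': "lip_factor * ?h \<le> 1 / 2" using small by simp
  have smallL: "L * ?h \<le> 1 / 2" using mult_right_mono[OF L_le_lip_factor h] small' by simp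
  have y: "w s = y" "y \<in> D" using sol sub(2) \<open>s < e\<close> by (auto simp: ivp_solution_def)
  have lip': "norm (f t y - f t y') \<le> L * norm (y - y')" if "t \<in> {s..e}" for t y y'
    using lip that sub(1) by blast
  have "?h ^ r \<le> ?h" using h \<open>?h \<le> H\<close> \<open>H \<le> 1\<close> r power_decreasing[of 1 r ?h] by simp
  then have hr: "remainder_const * ?h ^ r \<le> remainder_const * H"
    using \<open>?h \<le> H\<close> remainder_const_nonneg by (intro mult_left_mono) auto
  have E: "norm (f u (w u) - lagrange_interp r ?\<tau> (\<lambda>u. f u (w u)) u) \<le> remainder_const * H"
    if "u \<in> {s..e}" for u
    using order_trans[OF interpolation_error[OF sol sub nodes \<open>s < e\<close> that] hr] .
  let ?E = "remainder_const * H"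
  let ?d = "2 * norm (y - y') + ?h * (2 * ?E + 2 * M)"
  have d: "norm (w u - interp_iter f r ?\<tau> s y' r u) \<le> ?d" if "u \<in> {s..e}" for u
    by (rule picard_interp_perturbed_error[OF sol nodes \<open>s < e\<close> r lip' L E
          solution_stays_close[OF sol sub(1) y(2) smallL] _ that])
      (use small' in \<open>simp_all add: lip_factor_def\<close>)
  have "norm (w e - interp_iter f r ?\<tau> s y' (Suc r) e)
      \<le> norm (y - y') + ?h * (?E + lip_factor * ?d)"
    unfolding lip_factor_def
    by (rule picard_interp_step[OF sol nodes \<open>s < e\<close> r lip' L E d]) (use \<open>s < e\<close> in auto)
  also have "?h * (?E + lip_factor * ?d) = 2 * lip_factor * ?h * norm (y - y')
      + ?h * (?E + lip_factor * (?h * (2 * ?E + 2 * M)))"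
    by (simp add: algebra_simps)
  also have "?h * (?E + lip_factor * (?h * (2 * ?E + 2 * M))) \<le> ?h * (global_const * H)"
  proof (rule mult_left_mono[OF _ h])
    have "?h * (2 * ?E + 2 * M) \<le> H * (2 * remainder_const + 2 * M)"
      using \<open>?h \<le> H\<close> \<open>H \<le> 1\<close> h remainder_const_nonneg M0
      by (intro mult_mono add_mono) (auto simp: mult_left_le)
    then have "lip_factor * (?h * (2 * ?E + 2 * M)) \<le> lip_factor * (H * (2 * remainder_const + 2 * M))"
      using lip_factor_nonneg by (rule mult_left_mono)
    then show "?E + lip_factor * (?h * (2 * ?E + 2 * M)) \<le> global_const * H"
      by (simp add: global_const_def algebra_simps)
  qed
  finally show ?thesis by (simp add: local_approx_def algebra_simps del: interp_iter.simps)
qed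

text \<open>A discrete Gronwall argument on top of \<open>method_value_step\<close>. The method is compared with the
  solution \<open>z\<close>, which is known to lie in the tube and along which interpolation errors are therefore
  controlled; the distance of the computed values from \<open>z\<close> enters through the global Lipschitz
  condition only, so there is no circularity in deducing that they lie in the tube.\<close>
lemma method_values_converge:
  assumes sol: "ivp_solution f a b \<eta> z" and zD: "z ` {a..b} \<subseteq> D"
    and mesh: "mesh a b m x" and step: "\<And>i. i < m \<Longrightarrow> x (Suc i) - x i \<le> H"
    and H: "0 \<le> H" "H \<le> 1" "lip_factor * H \<le> 1 / 2" and "i \<le> m"
  shows "norm (z (x i) - method_values f r \<eta> x i)
    \<le> exp (2 * lip_factor * (x i - a)) * (x i - a) * (global_const * H)"
  using \<open>i \<le> m\<close>
proof (induction i)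
  case 0
  then show ?case using mesh sol by (simp add: mesh_def ivp_solution_def)
next
  case (Suc i)
  let ?h = "x (Suc i) - x i" and ?G = "global_const * H" and ?c = "2 * lip_factor"
  have i: "x i \<in> {a..b}" "x (Suc i) \<in> {a..b}" using mesh_bounds[OF mesh] Suc.prems by auto
  have lt: "x i < x (Suc i)" using mesh Suc.prems by (simp add: mesh_def)
  have G: "0 \<le> ?G"
    using H(1) remainder_const_nonneg lip_factor_nonneg M0 by (simp add: global_const_def)
  have "norm (z (x (Suc i)) - method_values f r \<eta> x (Suc i))
      \<le> (1 + ?c * ?h) * norm (z (x i) - method_values f r \<eta> x i) + ?h * ?G"
    unfolding method_values.simps
    by (rule method_value_step[OF ivp_solution_subinterval[OF sol]])
      (use i lt H step[of i] Suc.prems zD in auto)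
  also have "\<dots> \<le> exp (?c * ?h) * (exp (?c * (x i - a)) * (x i - a) * ?G) + ?h * ?G"
    using Suc.IH Suc.prems lt lip_factor_nonneg
    by (intro add_mono[OF mult_mono order_refl] exp_ge_add_one_self) auto
  also have "\<dots> = exp (?c * (x (Suc i) - a)) * (x i - a) * ?G + ?h * ?G"
  proof -
    have "?c * (x (Suc i) - a) = ?c * ?h + ?c * (x i - a)" by (simp add: algebra_simps)
    then have "exp (?c * (x (Suc i) - a)) = exp (?c * ?h) * exp (?c * (x i - a))"
      by (simp only: exp_add)
    then show ?thesis by (simp only: mult.assoc)
  qed
  also have "?h * ?G \<le> exp (?c * (x (Suc i) - a)) * (?h * ?G)"
  proof -
    have "0 \<le> ?c * (x (Suc i) - a)" using lip_factor_nonneg i by simp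
    then show ?thesis using mult_right_mono[of 1 "exp (?c * (x (Suc i) - a))" "?h * ?G"] lt G by simp
  qed
  finally show ?case by (simp add: algebra_simps)
qed

lemma local_const_nonneg: "0 \<le> local_const"
  using M0 lip_factor_nonneg remainder_const_nonneg by (simp add: local_const_def)

section \<open>Comparison with the divided difference\<close>

text \<open>The three thirds of \<open>\<beta>\<close> absorb the variation of \<open>F r\<close> between the two solutions,
  the change of the divided difference caused by the auxiliary approximation, and the
  perturbation in the last sweep of the method.\<close>
lemma local_error_component_bound:
  assumes sol: "ivp_solution f s e y z" and sub: "{s..e} \<subseteq> {a..b}" "{s..e'} \<subseteq> {a..b}"
    and lt: "s < e" "s < e'" and H: "e - s \<le> H" "e' - s \<le> H"
    and tube: "\<And>v. norm (v - y) \<le> 1 / 2 \<Longrightarrow> v \<in> D"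
    and unif: "\<And>p q. p \<in> {a..b} \<times> D \<Longrightarrow> q \<in> {a..b} \<times> D \<Longrightarrow> dist p q < \<epsilon> \<Longrightarrow>
        norm (F r p - F r q) \<le> \<beta> / 3"
    and small: "lip_factor * H \<le> 1 / 2" "2 * M * H \<le> 1 / 2" "H + 4 * M * H < \<epsilon>"
      "(2 * real r) ^ r * (L * local_const) * H \<le> \<beta> / 3" "lip_factor * local_const * H \<le> \<beta> / 3"
    and t: "t \<in> {s..e}"
  shows "\<bar>(z t - local_approx f r s e y t) $ c\<bar>
    \<le> (\<bar>divided_diff (H_tilde f r s e' y) (aux_nodes r s e') 0 r $ c\<bar> + \<beta>) * (e - s) ^ (r + 1)"
proof -
  let ?h = "e - s" and ?h' = "e' - s"
  have y: "y \<in> D" using tube by simp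
  have lip_small: "lip_factor * d \<le> 1 / 2" "L * d \<le> 1 / 2" if "0 \<le> d" "d \<le> H" for d
  proof -
    show "lip_factor * d \<le> 1 / 2" using mult_left_mono[OF that(2) lip_factor_nonneg] small(1) by simp
    then show "L * d \<le> 1 / 2" using mult_right_mono[OF L_le_lip_factor that(1)] by simp
  qed
  have "\<exists>w. ivp_solution f s e' y w"
  proof (rule lipschitz_ivp_has_solution[OF _ continuous_on_subset[OF cont] _ L])
    show "L * ?h' < 1" using lip_small(2)[of ?h'] lt H by simp
    show "norm (f t y - f t y') \<le> L * norm (y - y')" if "t \<in> {s..e'}" for t y y'
      using lip that sub(2) by blast
  qed (use lt sub in auto)
  then obtain w where w: "ivp_solution f s e' y w" ..
  have close: "norm (v u - y) \<le> 2 * M * H" "v u \<in> D"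
    if v: "ivp_solution f s T y v" "{s..T} \<subseteq> {a..b}" "s < T" "T - s \<le> H" "u \<in> {s..T}" for v T u
  proof -
    have "norm (v u - y) \<le> 2 * M * (T - s)"
      using solution_stays_close[OF v(1,2) y _ v(5)] lip_small(2)[of "T - s"] v(3,4) by simp
    also have "\<dots> \<le> 2 * M * H" using v(4) M0 by (intro mult_left_mono) auto
    finally show "norm (v u - y) \<le> 2 * M * H" .
    then show "v u \<in> D" using small(2) by (intro tube) simp
  qed
  have zD: "z ` {s..e} \<subseteq> D" and wD: "w ` {s..e'} \<subseteq> D"
    using close(2)[OF sol sub(1) lt(1) H(1)] close(2)[OF w sub(2) lt(2) H(2)] by auto

  have aux: "spaced_nodes r r s e' (aux_nodes r s e')"
    and aux': "spaced_nodes r (Suc r) s e' (aux_nodes r s e')"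
    by (rule spaced_aux_nodes[OF lt(2) r]; simp)+
  define \<Delta> where "\<Delta> g = divided_diff g (aux_nodes r s e') 0 r" for g :: "real \<Rightarrow> real ^ 'd"
  obtain \<zeta> where \<zeta>: "\<zeta> \<in> {s..e'}" "\<Delta> (\<lambda>u. f u (w u)) $ c = F r (\<zeta>, w \<zeta>) $ c / fact r"
    using divided_diff_mean_value[of r s e' "\<lambda>k t. F k (t, w t) $ c" "aux_nodes r s e'"]
      F_component_derivative[OF w sub(2) wD] spaced_nodes_inj_on[OF aux' lt(2)] aux'
    by (auto simp: \<Delta>_def spaced_nodes_def divided_diff_nth F_0 lessThan_Suc_atMost less_Suc_eq_le)

  have "norm (\<Delta> (\<lambda>u. f u (w u)) - \<Delta> (H_tilde f r s e' y)) \<le> (2 * real r / ?h') ^ r * (L * (local_const * ?h' ^ (r + 1)))"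
    unfolding \<Delta>_def divided_diff_diff
  proof (rule norm_divided_diff_le[OF aux' lt(2) r])
    fix u assume u: "u \<in> {s..e'}"
    have "norm (w u - aux_approx f r s e' y u) \<le> local_const * ?h' ^ (r + 1)"
      unfolding aux_approx_def
      by (rule iterate_local_error[OF w sub(2) wD aux lt(2) lip_small(1) _ _ u]) (use lt H in auto)
    from mult_left_mono[OF this L]
    show "norm (f u (w u) - H_tilde f r s e' y u) \<le> L * (local_const * ?h' ^ (r + 1))"
      unfolding H_tilde_def using lip[of u] u sub(2) order_trans by blast
  qed simp
  also have "\<dots> = (2 * real r) ^ r * (L * local_const) * ?h'"
    using lt(2) by (simp add: power_divide)
  also have "\<dots> \<le> (2 * real r) ^ r * (L * local_const) * H"
    using H(2) L local_const_nonneg by (intro mult_left_mono) auto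
  finally have "norm (\<Delta> (\<lambda>u. f u (w u)) - \<Delta> (H_tilde f r s e' y)) \<le> \<beta> / 3" using small(4) by simp
  then have "\<bar>(\<Delta> (\<lambda>u. f u (w u)) - \<Delta> (H_tilde f r s e' y)) $ c\<bar> \<le> \<beta> / 3"
    using component_le_norm_cart order_trans by blast
  then have \<Delta>: "\<bar>\<Delta> (\<lambda>u. f u (w u)) $ c\<bar> \<le> \<bar>\<Delta> (H_tilde f r s e' y) $ c\<bar> + \<beta> / 3"
    unfolding vector_minus_component by linarith

  (* A bounds the c-th component of the r-th derivative along z on the whole step. The comparison
     goes through the point \<zeta> on w: both curves start at y, so they are close. *)
  define A where "A = \<bar>F r (\<zeta>, w \<zeta>) $ c\<bar> + \<beta> / 3"
  have \<beta>: "0 \<le> \<beta> / 3"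
    using small(5) lip_factor_nonneg local_const_nonneg H lt by (intro order_trans[OF _ small(5)]) auto
  have A: "\<bar>F r (u, z u) $ c\<bar> \<le> A" if u: "u \<in> {s..e}" for u
  proof -
    have "norm (z u - w \<zeta>) \<le> 2 * M * H + 2 * M * H"
      using norm_triangle_ineq4[of "z u - y" "w \<zeta> - y"] close(1)[OF sol sub(1) lt(1) H(1) u]
        close(1)[OF w sub(2) lt(2) H(2) \<zeta>(1)] unfolding diff_diff_eq2 diff_add_cancel by linarith
    moreover have "\<bar>u - \<zeta>\<bar> \<le> H" using u \<zeta>(1) H by auto
    moreover have "dist (u, z u) (\<zeta>, w \<zeta>) \<le> \<bar>u - \<zeta>\<bar> + norm (z u - w \<zeta>)"
      using sqrt_sum_squares_le_sum[of "\<bar>u - \<zeta>\<bar>" "norm (z u - w \<zeta>)"]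
      by (simp add: dist_norm norm_Pair)
    ultimately have "dist (u, z u) (\<zeta>, w \<zeta>) < \<epsilon>" using small(3) by (simp add: mult_ac)
    then have "norm (F r (u, z u) - F r (\<zeta>, w \<zeta>)) \<le> \<beta> / 3"
      using u \<zeta>(1) sub zD wD by (intro unif) auto
    then have "\<bar>(F r (u, z u) - F r (\<zeta>, w \<zeta>)) $ c\<bar> \<le> \<beta> / 3"
      using component_le_norm_cart order_trans by blast
    then show ?thesis unfolding A_def vector_minus_component by linarith
  qed
  have "A / fact r \<le> \<bar>\<Delta> (\<lambda>u. f u (w u)) $ c\<bar> + \<beta> / 3"
  proof -
    have "\<beta> / 3 / fact r \<le> \<beta> / 3"
      using \<beta> fact_ge_1[of r, where 'a = real] mult_left_mono[of 1 "fact r" "\<beta> / 3"] by (simp add: divide_le_eq)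
    then show ?thesis using \<zeta>(2) by (simp add: A_def add_divide_distrib)
  qed
  with \<Delta> have A': "A / fact r \<le> \<bar>\<Delta> (H_tilde f r s e' y) $ c\<bar> + 2 * \<beta> / 3" by simp

  have nodes: "spaced_nodes r r s e (method_nodes r s e)" using spaced_method_nodes[OF lt(1) r] .
  have lip': "norm (f t y - f t y') \<le> L * norm (y - y')" if "t \<in> {s..e}" for t y y'
    using lip that sub(1) by blast
  have it: "norm (z u - interp_iter f r (method_nodes r s e) s y r u) \<le> local_const * ?h ^ (r + 1)"
    if "u \<in> {s..e}" for u
    by (rule iterate_local_error[OF sol sub(1) zD nodes lt(1) lip_small(1) _ _ that]) (use lt H in auto)
  have "\<bar>(z t - local_approx f r s e y t) $ c\<bar>
      \<le> ?h * (A / fact r * ?h ^ r + lebesgue_bound r * L * (local_const * ?h ^ (r + 1)))"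
    unfolding local_approx_def Suc_eq_plus1[symmetric]
    by (rule picard_interp_component_error[OF sol nodes lt(1) r lip' L
          interpolation_component_error[OF sol sub(1) zD nodes lt(1) A] it[unfolded Suc_eq_plus1[symmetric]] t])
  also have "\<dots> = (A / fact r + lip_factor * local_const * ?h) * ?h ^ (r + 1)"
    by (simp add: lip_factor_def distrib_left distrib_right mult_ac)
  also have "\<dots> \<le> (\<bar>\<Delta> (H_tilde f r s e' y) $ c\<bar> + \<beta>) * ?h ^ (r + 1)"
  proof (rule mult_right_mono)
    have "lip_factor * local_const * ?h \<le> lip_factor * local_const * H"
      using H(1) lip_factor_nonneg local_const_nonneg by (intro mult_left_mono) auto
    then show "A / fact r + lip_factor * local_const * ?h \<le> \<bar>\<Delta> (H_tilde f r s e' y) $ c\<bar> + \<beta>"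
      using A' small(5) by simp
  qed (use lt in simp)
  finally show ?thesis by (simp add: \<Delta>_def)
qed

end

section \<open>The class of right-hand sides and the error bound\<close>
lemma infnorm_le_componentwise:
  fixes x :: "real ^ 'd"
  assumes "\<And>c. \<bar>x $ c\<bar> \<le> B"
  shows "infnorm x \<le> B"
  unfolding infnorm_cart by (rule cSup_least) (use assms in auto)

lemma solution_tube_compact:
  fixes z :: "real \<Rightarrow> real ^ 'd"
  shows "compact (solution_tube a b z)"
proof -
  let ?B = "(SUP t\<in>{a..b}. infnorm (z t)) + 1"
  have "closed (solution_tube a b z)"
    unfolding solution_tube_def by (intro closed_Collect_le continuous_intros)
  moreover have "norm y \<le> sqrt DIM(real ^ 'd) * ?B" if "y \<in> solution_tube a b z" for y
    using that norm_le_infnorm[of y] unfolding solution_tube_def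
    by (auto intro: order_trans mult_left_mono)
  then have "bounded (solution_tube a b z)" unfolding bounded_iff by blast
  ultimately show ?thesis by (simp add: compact_eq_bounded_closed)
qed

lemma near_solution_in_tube:
  assumes "continuous_on {a..b} z" "t \<in> {a..b}" "norm (y - z t) \<le> 1"
  shows "y \<in> solution_tube a b z"
proof -
  have "compact ((\<lambda>t. infnorm (z t)) ` {a..b})"
    using assms(1) by (intro compact_continuous_image continuous_intros) auto
  then have "infnorm (z t) \<le> (SUP t\<in>{a..b}. infnorm (z t))"
    using assms(2) by (intro cSUP_upper bounded_imp_bdd_above compact_imp_bounded)
  moreover have "infnorm y \<le> infnorm (z t) + infnorm (y - z t)"
    using infnorm_triangle[of "z t" "y - z t"] by simp
  moreover have "infnorm (y - z t) \<le> 1" using infnorm_le_norm order_trans assms(3) by blast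
  ultimately show ?thesis by (simp add: solution_tube_def)
qed

text \<open>Passing from the maximum norm to the Euclidean norm multiplies the Lipschitz constant by the square
  root of the dimension.\<close>
lemma F_class_smooth_ivp:
  fixes f :: "real \<Rightarrow> real ^ 'd \<Rightarrow> real ^ 'd"
  assumes f: "f \<in> F_class a b \<eta> r" and r: "r \<ge> 1"
  shows "\<exists>z L M F. ivp_solution f a b \<eta> z \<and> smooth_ivp f a b L M r (solution_tube a b z) F \<and>
    continuous_on ({a..b} \<times> solution_tube a b z) (F r)"
proof -
  obtain L z where L: "0 \<le> L"
    and lip: "\<And>t y y'. t \<in> {a..b} \<Longrightarrow> infnorm (f t y - f t y') \<le> L * infnorm (y - y')"
    and z: "ivp_solution f a b \<eta> z"
    and C: "C_on r ({a..b} \<times> solution_tube a b z) (\<lambda>(t, y). f t y)"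
    and cont: "continuous_on ({a..b} \<times> UNIV) (\<lambda>(t, y). f t y)"
    using f unfolding F_class_def by blast
  let ?S = "{a..b} \<times> solution_tube a b z"
  have comp: "compact ?S" by (intro compact_Times solution_tube_compact) simp
  have "bounded_linear (\<lambda>v. (0, v) :: real \<times> (real ^ 'd))"
    by (intro bounded_linear_Pair bounded_linear_zero bounded_linear_ident)
  from C_on_add[OF C_on_const[of r ?S "(1 :: real, 0)"] C_on_bounded_linear[OF this C]]
  have "C_on r ?S (\<lambda>x. (1 :: real, f (fst x) (snd x)))" by (simp add: case_prod_unfold)
  from iterated_directional_derivatives[OF C this] obtain F where
    F: "F 0 = (\<lambda>(t, y). f t y)" "\<And>k. k \<le> r \<Longrightarrow> continuous_on ?S (F k)"
      "\<And>k x. k < r \<Longrightarrow> x \<in> ?S \<Longrightarrow>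
         \<exists>A. (F k has_derivative A) (at x within ?S) \<and> F (Suc k) x = A (1, f (fst x) (snd x))"
    by blast
  have "\<exists>B. \<forall>x\<in>?S. norm (F k x) \<le> B" if "k \<le> r" for k
    using compact_imp_bounded[OF compact_continuous_image[OF F(2)[OF that] comp]]
    unfolding bounded_iff by auto
  then obtain B where B: "\<And>k x. k \<le> r \<Longrightarrow> x \<in> ?S \<Longrightarrow> norm (F k x) \<le> B k" by metis
  define M where "M = (\<Sum>k\<le>r. \<bar>B k\<bar>)"
  have "norm (F k x) \<le> M" if "k \<le> r" "x \<in> ?S" for k x
    using B[OF that] member_le_sum[of k "{..r}" "\<lambda>k. \<bar>B k\<bar>"] that(1) unfolding M_def by simp
  moreover have "norm (f t y - f t y') \<le> sqrt DIM(real ^ 'd) * L * norm (y - y')" if "t \<in> {a..b}" for t y y'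
  proof -
    have "norm (f t y - f t y') \<le> sqrt DIM(real ^ 'd) * infnorm (f t y - f t y')"
      by (rule norm_le_infnorm)
    also have "\<dots> \<le> sqrt DIM(real ^ 'd) * (L * norm (y - y'))"
      using order_trans[OF lip[OF that] mult_left_mono[OF infnorm_le_norm L]]
      by (intro mult_left_mono) auto
    finally show ?thesis by simp
  qed
  moreover have "0 \<le> M" unfolding M_def by (simp add: sum_nonneg)
  ultimately have "smooth_ivp f a b (sqrt DIM(real ^ 'd) * L) M r (solution_tube a b z) F"
    using r L cont F by unfold_locales auto
  then show ?thesis using z F(2) by blast
qed

lemma eventually_mult_less_at_right_0:
  fixes X y :: real
  assumes "0 < y"
  shows "eventually (\<lambda>H. X * H < y) (at_right 0)"
proof -
  have "((\<lambda>H. X * H) \<longlongrightarrow> X * 0) (at_right 0)" by (intro tendsto_intros)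
  then show ?thesis using assms by (intro order_tendstoD(2)) auto
qed

theorem theorem2:
  fixes a b K \<gamma> \<beta> \<phi> :: real
    and r :: nat
    and \<eta> :: "real ^ 'd"
    and f :: "real \<Rightarrow> real ^ 'd \<Rightarrow> real ^ 'd"
    and ell :: "nat \<Rightarrow> real"
  assumes "a < b" and "r \<ge> 1"
    and "decseq ell" and "ell \<longlonglongrightarrow> 0"
    and "\<gamma> \<ge> 1"
    and "f \<in> F_class a b \<eta> r"
    and "\<beta> > 0" and "0 < \<phi>" and "\<phi> < 1"
  shows "\<exists>m0. \<forall>m\<ge>m0. \<forall>x xbar.
    mesh a b m x \<longrightarrow> mesh_size m x \<le> K * ell m \<longrightarrow>
    (\<forall>i<m. x i < xbar (Suc i) \<and> xbar (Suc i) \<le> b \<and>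
           xbar (Suc i) - x i \<le> \<gamma> * (x (Suc i) - x i)) \<longrightarrow>
    (\<forall>i<m. \<forall>zi. ivp_solution f (x i) (x (Suc i)) (method_values f r \<eta> x i) zi \<longrightarrow>
      (SUP t\<in>{x i..x (Suc i)}.
         infnorm (zi t - local_approx f r (x i) (x (Suc i)) (method_values f r \<eta> x i) t))
      \<le> G_coeff f r \<beta> \<phi> (x i) (xbar (Suc i)) (method_values f r \<eta> x i) * (x (Suc i) - x i) ^ (r + 1))"
proof -
  obtain z L M F where z: "ivp_solution f a b \<eta> z"
    and "smooth_ivp f a b L M r (solution_tube a b z) F"
    and contF: "continuous_on ({a..b} \<times> solution_tube a b z) (F r)"
    using F_class_smooth_ivp[OF assms(6,2)] by blast
  then interpret smooth_ivp f a b L M r "solution_tube a b z" F by blast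
  let ?D = "solution_tube a b z"
  have contz: "continuous_on {a..b} z" using ivp_solution_continuous_on[OF z] .
  have zD: "z ` {a..b} \<subseteq> ?D" using near_solution_in_tube[OF contz] by auto
  have "uniformly_continuous_on ({a..b} \<times> ?D) (F r)"
    by (intro compact_uniformly_continuous contF compact_Times solution_tube_compact) simp
  then obtain \<epsilon> where "0 < \<epsilon>" and \<epsilon>:
    "\<And>p q. p \<in> {a..b} \<times> ?D \<Longrightarrow> q \<in> {a..b} \<times> ?D \<Longrightarrow> dist p q < \<epsilon> \<Longrightarrow> dist (F r p) (F r q) < \<beta> / 3"
    using \<open>\<beta> > 0\<close> unfolding uniformly_continuous_on_def
    by (metis dist_commute divide_pos_pos zero_less_numeral)
  (* H bounds the mesh steps and the auxiliary intervals; it satisfies finitely many conditions that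
     all hold for small H. *)
  have "\<forall>\<^sub>F H in at_right 0. 0 < H \<and> 1 * H < 1 \<and> lip_factor * H < 1 / 2 \<and> (2 * M) * H < 1 / 2 \<and>
      (1 + 4 * M) * H < \<epsilon> \<and> ((2 * real r) ^ r * (L * local_const)) * H < \<beta> / 3 \<and>
      (lip_factor * local_const) * H < \<beta> / 3 \<and>
      (exp (2 * lip_factor * (b - a)) * (b - a) * global_const) * H < 1 / 2"
    using \<open>\<beta> > 0\<close> \<open>0 < \<epsilon>\<close>
    by (intro eventually_conj eventually_at_right_less eventually_mult_less_at_right_0) auto
  from eventually_happens[OF this] obtain H where H: "0 < H" "H < 1" "lip_factor * H < 1 / 2"
    "2 * M * H < 1 / 2" "H + 4 * M * H < \<epsilon>" "(2 * real r) ^ r * (L * local_const) * H < \<beta> / 3"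
    "lip_factor * local_const * H < \<beta> / 3"
    "exp (2 * lip_factor * (b - a)) * (b - a) * (global_const * H) < 1 / 2"
    by (auto simp: algebra_simps)
  have "(\<lambda>m. K * ell m) \<longlonglongrightarrow> K * 0" using assms(4) by (intro tendsto_intros)
  moreover have "K * 0 < H / \<gamma>" using H(1) assms(5) by simp
  ultimately have "\<forall>\<^sub>F m in sequentially. K * ell m < H / \<gamma>" by (rule order_tendstoD(2))
  then obtain m0 where m0: "\<And>m. m \<ge> m0 \<Longrightarrow> K * ell m < H / \<gamma>"
    unfolding eventually_sequentially by blast
  show ?thesis
  proof (intro exI[of _ m0] allI impI)
    fix m x xbar i zi
    assume "m0 \<le> m" and mesh: "mesh a b m x" and size: "mesh_size m x \<le> K * ell m"
      and xbar: "\<forall>i<m. x i < xbar (Suc i) \<and> xbar (Suc i) \<le> b \<and>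
           xbar (Suc i) - x i \<le> \<gamma> * (x (Suc i) - x i)"
      and i: "i < m" and zi: "ivp_solution f (x i) (x (Suc i)) (method_values f r \<eta> x i) zi"
    have stepg: "\<gamma> * (x (Suc j) - x j) \<le> H" if "j < m" for j
    proof -
      have "x (Suc j) - x j \<le> mesh_size m x" unfolding mesh_size_def using that by (intro Max_ge) auto
      then have "x (Suc j) - x j \<le> H / \<gamma>" using size m0[OF \<open>m0 \<le> m\<close>] by simp
      then show ?thesis using assms(5) by (simp add: field_simps)
    qed
    have step: "x (Suc j) - x j \<le> H" if "j < m" for j
    proof -
      have "1 * (x (Suc j) - x j) \<le> \<gamma> * (x (Suc j) - x j)"
        using assms(5) mesh that by (intro mult_right_mono) (auto simp: mesh_def less_imp_le)
      then show ?thesis using stepg[OF that] by simp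
    qed
    define y where "y = method_values f r \<eta> x i"
    let ?\<Delta> = "divided_diff (H_tilde f r (x i) (xbar (Suc i)) y) (aux_nodes r (x i) (xbar (Suc i))) 0 r"
    let ?h = "x (Suc i) - x i"
    have lt: "x i < x (Suc i)" using mesh i by (simp add: mesh_def)
    have xi: "x i \<in> {a..b}" "x (Suc i) \<in> {a..b}" using mesh_bounds[OF mesh] i by auto
    have "norm (z (x i) - y) \<le> exp (2 * lip_factor * (x i - a)) * (x i - a) * (global_const * H)"
      unfolding y_def
      by (rule method_values_converge[OF z zD mesh step]) (use H i in auto)
    also have "\<dots> \<le> exp (2 * lip_factor * (b - a)) * (b - a) * (global_const * H)"
      using xi(1) lip_factor_nonneg H(1) remainder_const_nonneg M0
      by (intro mult_right_mono mult_mono) (auto simp: global_const_def intro!: mult_left_mono)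
    finally have y: "norm (z (x i) - y) \<le> 1 / 2" using H(8) by simp
    have tube: "v \<in> ?D" if "norm (v - y) \<le> 1 / 2" for v
    proof (rule near_solution_in_tube[OF contz xi(1)])
      show "norm (v - z (x i)) \<le> 1"
        using norm_triangle_le_diff[of "v - y" "z (x i) - y" 1] that y by simp
    qed
    have bound: "infnorm (zi t - local_approx f r (x i) (x (Suc i)) y t)
        \<le> (infnorm ?\<Delta> + \<beta>) * ?h ^ (r + 1)" if t: "t \<in> {x i..x (Suc i)}" for t
    proof (rule infnorm_le_componentwise)
      fix c
      have "\<bar>(zi t - local_approx f r (x i) (x (Suc i)) y t) $ c\<bar> \<le> (\<bar>?\<Delta> $ c\<bar> + \<beta>) * ?h ^ (r + 1)"
      proof (rule local_error_component_bound[where H = H and \<epsilon> = \<epsilon>])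
        show "ivp_solution f (x i) (x (Suc i)) y zi" using zi by (simp add: y_def)
        show "xbar (Suc i) - x i \<le> H" using xbar i stepg[OF i] by force
        show "norm (F r p - F r q) \<le> \<beta> / 3"
          if "p \<in> {a..b} \<times> ?D" "q \<in> {a..b} \<times> ?D" "dist p q < \<epsilon>" for p q
          using \<epsilon>[OF that] by (simp add: dist_norm)
      qed (use lt xi xbar i step tube t H in auto)
      also have "\<dots> \<le> (infnorm ?\<Delta> + \<beta>) * ?h ^ (r + 1)"
        using lt component_le_infnorm_cart by (intro mult_right_mono add_right_mono) auto
      finally show "\<bar>(zi t - local_approx f r (x i) (x (Suc i)) y t) $ c\<bar> \<le> (infnorm ?\<Delta> + \<beta>) * ?h ^ (r + 1)" .
    qed
    (* The factor 8 / 3 * (1 + \<phi>) is at least 1. *)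
    have "infnorm ?\<Delta> + \<beta> \<le> G_coeff f r \<beta> \<phi> (x i) (xbar (Suc i)) y"
    proof -
      have "0 \<le> infnorm ?\<Delta> + \<beta>" using infnorm_pos_le[of ?\<Delta>] \<open>\<beta> > 0\<close> by simp
      moreover have "1 \<le> 8 / 3 * (1 + \<phi>)" using \<open>0 < \<phi>\<close> by simp
      ultimately have "1 * (infnorm ?\<Delta> + \<beta>) \<le> 8 / 3 * (1 + \<phi>) * (infnorm ?\<Delta> + \<beta>)"
        by (intro mult_right_mono)
      then show ?thesis unfolding G_coeff_def by (simp only: mult_ac mult_1)
    qed
    from mult_right_mono[OF this, of "?h ^ (r + 1)"] lt
    have G: "(infnorm ?\<Delta> + \<beta>) * ?h ^ (r + 1)
        \<le> G_coeff f r \<beta> \<phi> (x i) (xbar (Suc i)) y * ?h ^ (r + 1)" by simp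
    show "(SUP t\<in>{x i..x (Suc i)}.
         infnorm (zi t - local_approx f r (x i) (x (Suc i)) (method_values f r \<eta> x i) t))
      \<le> G_coeff f r \<beta> \<phi> (x i) (xbar (Suc i)) (method_values f r \<eta> x i) * (x (Suc i) - x i) ^ (r + 1)"
      unfolding y_def[symmetric] using lt order_trans[OF bound G] by (intro cSUP_least) auto
  qed
qed

end
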